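(* Let $\rho$ satisfy the wave equation $\square^{2}(\rho)=0$, with the initial conditions $\frac{\partial\rho}{\partial t}\big|_{t=0}=0$ and $\rho|_{t=0}\in\mathcal{S}(\mathbb{R}^{3})$. Then there exists $\overline{J}$ such that $(\rho,\overline{J})$ satisfies the continuity equation $\frac{\partial\rho}{\partial t}+\nabla\cdot\overline{J}=0$, $\overline{J}$ satisfies the wave equation $\square^{2}(\overline{J})=\overline{0}$ with $\nabla\times\overline{J}=\overline{0}$, and there exist $(\overline{E},\overline{B})$ such that $(\rho,\overline{J},\overline{E},\overline{B})$ satisfy Maxwell's equations, with $\square^{2}(\overline{E})=\overline{0}$ and $\overline{B}=\overline{0}$. In particular, the Poynting vector $\overline{E}\times\overline{B}$ is $\overline{0}$.
   Context: All quantities are smooth functions of $(\overline{x},t)\in\mathbb{R}^{3}\times\mathbb{R}$, with $\rho$ scalar valued and $\overline{J},\overline{E},\overline{B}$ vector valued. $\epsilon_{0},\mu_{0}>0$ are constants. $\mathcal{S}(\mathbb{R}^{3})$ is the Schwartz class. $\square^{2}=\nabla^{2}-\mu_{0}\epsilon_{0}\frac{\partial^{2}}{\partial t^{2}}$, acting componentwise on vector fields. Maxwell's equations for $(\rho,\overline{J},\overline{E},\overline{B})$ are: $\nabla\cdot\overline{E}=\rho/\epsilon_{0}$, $\nabla\cdot\overline{B}=0$, $\nabla\times\overline{E}=-\frac{\partial\overline{B}}{\partial t}$, $\nabla\times\overline{B}=\mu_{0}\overline{J}+\mu_{0}\epsilon_{0}\frac{\partial\overline{E}}{\partial t}$. 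*)

theory Defs
  imports "HOL-Analysis.Analysis"
begin

text \<open>
  Continuity of \<open>f\<close> and of all its iterated directional derivatives up to order \<open>k\<close>; as
  the domain is finite-dimensional, this is the usual class of \<open>k\<close> times continuously
  differentiable functions on the whole space.
\<close>

primrec times_cont_differentiable ::
    "nat \<Rightarrow> ('a::euclidean_space \<Rightarrow> 'b::real_normed_vector) \<Rightarrow> bool" where
  "times_cont_differentiable 0 f \<longleftrightarrow> continuous_on UNIV f"
| "times_cont_differentiable (Suc k) f \<longleftrightarrow>
     (\<forall>x. f differentiable (at x)) \<and>
     (\<forall>v. times_cont_differentiable k (\<lambda>x. frechet_derivative f (at x) v))"

definition smooth :: "('a::euclidean_space \<Rightarrow> 'b::real_normed_vector) \<Rightarrow> bool" where
  "smooth f \<longleftrightarrow> (\<forall>k. times_cont_differentiable k f)"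

definition partial_deriv :: "3 \<Rightarrow> (real^3 \<Rightarrow> real) \<Rightarrow> real^3 \<Rightarrow> real" where
  "partial_deriv i f x = frechet_derivative f (at x) (axis i 1)"

definition multi_deriv :: "nat^3 \<Rightarrow> (real^3 \<Rightarrow> real) \<Rightarrow> real^3 \<Rightarrow> real" where
  "multi_deriv \<beta> f =
     (partial_deriv 1 ^^ (\<beta> $ 1)) ((partial_deriv 2 ^^ (\<beta> $ 2)) ((partial_deriv 3 ^^ (\<beta> $ 3)) f))"

definition schwartz :: "(real^3 \<Rightarrow> real) set" where
  "schwartz = {f. smooth f \<and>
     (\<forall>\<alpha> \<beta> :: nat^3. bounded (range (\<lambda>x. (\<Prod>i\<in>UNIV. x $ i ^ (\<alpha> $ i)) * multi_deriv \<beta> f x)))}"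

definition laplacian :: "(real^3 \<Rightarrow> real) \<Rightarrow> real^3 \<Rightarrow> real" where
  "laplacian f x = (\<Sum>i\<in>UNIV. partial_deriv i (partial_deriv i f) x)"

definition divergence :: "(real^3 \<Rightarrow> real^3) \<Rightarrow> real^3 \<Rightarrow> real" where
  "divergence F x = (\<Sum>i\<in>UNIV. partial_deriv i (\<lambda>y. F y $ i) x)"

definition curl :: "(real^3 \<Rightarrow> real^3) \<Rightarrow> real^3 \<Rightarrow> real^3" where
  "curl F x = vector
     [partial_deriv 2 (\<lambda>y. F y $ 3) x - partial_deriv 3 (\<lambda>y. F y $ 2) x,
      partial_deriv 3 (\<lambda>y. F y $ 1) x - partial_deriv 1 (\<lambda>y. F y $ 3) x,
      partial_deriv 1 (\<lambda>y. F y $ 2) x - partial_deriv 2 (\<lambda>y. F y $ 1) x]"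

text \<open>
  Time-dependent quantities are curried, as functions of the position \<open>x\<close> and the time \<open>t\<close>.
  Their smoothness is always meant jointly in \<open>(x, t)\<close>.
\<close>

definition smooth_field :: "(real^3 \<Rightarrow> real \<Rightarrow> 'b::real_normed_vector) \<Rightarrow> bool" where
  "smooth_field f \<longleftrightarrow> smooth (\<lambda>(x, t). f x t)"

definition time_deriv ::
    "(real^3 \<Rightarrow> real \<Rightarrow> 'b::real_normed_vector) \<Rightarrow> real^3 \<Rightarrow> real \<Rightarrow> 'b" where
  "time_deriv f x t = vector_derivative (f x) (at t)"

definition wave_op ::
    "real \<Rightarrow> real \<Rightarrow> (real^3 \<Rightarrow> real \<Rightarrow> real) \<Rightarrow> real^3 \<Rightarrow> real \<Rightarrow> real" where
  "wave_op \<epsilon>\<^sub>0 \<mu>\<^sub>0 f x t =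
     laplacian (\<lambda>y. f y t) x - \<mu>\<^sub>0 * \<epsilon>\<^sub>0 * time_deriv (time_deriv f) x t"

definition wave_op_vec ::
    "real \<Rightarrow> real \<Rightarrow> (real^3 \<Rightarrow> real \<Rightarrow> real^3) \<Rightarrow> real^3 \<Rightarrow> real \<Rightarrow> real^3" where
  "wave_op_vec \<epsilon>\<^sub>0 \<mu>\<^sub>0 F x t = (\<chi> i. wave_op \<epsilon>\<^sub>0 \<mu>\<^sub>0 (\<lambda>y s. F y s $ i) x t)"

definition maxwell ::
    "real \<Rightarrow> real \<Rightarrow> (real^3 \<Rightarrow> real \<Rightarrow> real) \<Rightarrow> (real^3 \<Rightarrow> real \<Rightarrow> real^3) \<Rightarrow>
     (real^3 \<Rightarrow> real \<Rightarrow> real^3) \<Rightarrow> (real^3 \<Rightarrow> real \<Rightarrow> real^3) \<Rightarrow> bool" where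
  "maxwell \<epsilon>\<^sub>0 \<mu>\<^sub>0 \<rho> J E B \<longleftrightarrow> (\<forall>x t.
     divergence (\<lambda>y. E y t) x = \<rho> x t / \<epsilon>\<^sub>0 \<and>
     divergence (\<lambda>y. B y t) x = 0 \<and>
     curl (\<lambda>y. E y t) x = - time_deriv B x t \<and>
     curl (\<lambda>y. B y t) x = \<mu>\<^sub>0 *\<^sub>R J x t + (\<mu>\<^sub>0 * \<epsilon>\<^sub>0) *\<^sub>R time_deriv E x t)"

end

theory Submission
  imports Defs
begin

text \<open>
  With \<open>B = 0\<close> Maxwell's equations say that \<open>E\<close> is curl free, that \<open>div E = \<rho> / \<epsilon>\<^sub>0\<close> and that
  \<open>J = - \<epsilon>\<^sub>0 \<partial>E/\<partial>t\<close>.  So everything follows from one smooth scalar function \<open>\<Phi>\<close> of space and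
  time with
    \<open>\<nabla>\<^sup>2 \<Phi> = \<rho> / \<epsilon>\<^sub>0\<close> and \<open>\<nabla>\<^sup>2 \<Phi> = \<mu>\<^sub>0 \<epsilon>\<^sub>0 \<partial>\<^sup>2\<Phi>/\<partial>t\<^sup>2\<close>:
  put \<open>E = \<nabla>\<Phi>\<close> and \<open>J = - \<epsilon>\<^sub>0 \<nabla>(\<partial>\<Phi>/\<partial>t)\<close>.  Partial derivatives commute (\<open>dir_deriv_commute\<close>), so gradients are curl
  free and inherit the wave equation from their potential, and the divergence of \<open>J\<close> is
  \<open>- \<epsilon>\<^sub>0 \<partial>/\<partial>t (\<rho> / \<epsilon>\<^sub>0)\<close>, which is the continuity equation.

  To find \<open>\<Phi>\<close>, solve Poisson's equation \<open>\<nabla>\<^sup>2 \<psi> = \<rho>(\<cdot>, 0)\<close> at time zero only, and let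
    \<open>\<Phi>(x, t) = 1 / \<epsilon>\<^sub>0 \<cdot> (\<psi>(x) + 1 / (\<mu>\<^sub>0 \<epsilon>\<^sub>0) \<cdot> (A (A \<rho>))(x, t))\<close>,
  where \<open>A\<close> is the antiderivative in time that vanishes at time zero.  The second time derivative of
  \<open>\<Phi>\<close> is clearly \<open>\<rho> / (\<mu>\<^sub>0 \<epsilon>\<^sub>0\<^sup>2)\<close>.  For the Laplacian, the wave equation turns \<open>\<nabla>\<^sup>2 \<rho>\<close> under
  the double time integral into a second time derivative, and because \<open>\<partial>\<rho>/\<partial>t\<close> vanishes at time
  zero the double integral of that derivative is \<open>\<rho>(x, t) - \<rho>(x, 0)\<close>; the Laplacian of \<open>\<psi>\<close> supplies
  the missing \<open>\<rho>(x, 0)\<close> (\<open>space_laplacian_wave_potential\<close>).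

  Poisson's equation is solved by the Newtonian potential
  \<open>N f (x) = \<integral> f (x + y) / |y| dy\<close> of a Schwartz function \<open>f\<close>.  Differentiation under the integral sign
  (\<open>has_derivative_integral_dominated\<close>) puts all derivatives on \<open>f\<close>, so \<open>N f\<close> is smooth and \<open>\<nabla>\<^sup>2 (N f) = N (\<nabla>\<^sup>2 f)\<close>.  Replace \<open>1/|y|\<close> by the smooth kernel
  \<open>K\<^sub>\<epsilon>(y) = (|y|\<^sup>2 + \<epsilon>\<^sup>2)\<^sup>-\<^sup>1\<^sup>/\<^sup>2\<close>, whose Laplacian is \<open>- 3 \<epsilon>\<^sup>2 K\<^sub>\<epsilon>\<^sup>5\<close>, and integrate by parts
  twice; after the substitution \<open>y = \<epsilon> z\<close> the limit \<open>\<epsilon> \<rightarrow> 0\<close> gives \<open>N (\<nabla>\<^sup>2 f) = - c f\<close> with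
  \<open>c = \<integral> 3 K\<^sub>1\<^sup>5 > 0\<close> (\<open>newton_potential_laplacian\<close>).  The integrability of these kernels in space is read off from majorants
  that are products of functions of one coordinate.
\<close>

section \<open>Calculus of smooth functions\<close>

definition dir_deriv :: "'a \<Rightarrow> ('a::euclidean_space \<Rightarrow> 'b::real_normed_vector) \<Rightarrow> 'a \<Rightarrow> 'b" where
  "dir_deriv v f = (\<lambda>x. frechet_derivative f (at x) v)"

lemma has_derivative_dir_deriv:
  "f differentiable (at x) \<Longrightarrow> (f has_derivative (\<lambda>v. dir_deriv v f x)) (at x)"
  unfolding dir_deriv_def using frechet_derivative_works[of f "at x"] by simp

lemma dir_deriv_eqI: "(f has_derivative f') (at x) \<Longrightarrow> dir_deriv v f x = f' v"
  unfolding dir_deriv_def by (simp add: frechet_derivative_at[symmetric])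

lemma dir_deriv_basis_sum:
  assumes "f differentiable (at x)"
  shows "dir_deriv v f x = (\<Sum>b\<in>Basis. (v \<bullet> b) *\<^sub>R dir_deriv b f x)"
proof -
  interpret bounded_linear "\<lambda>v. dir_deriv v f x"
    by (rule has_derivative_bounded_linear[OF has_derivative_dir_deriv[OF assms]])
  have "dir_deriv v f x = dir_deriv (\<Sum>b\<in>Basis. (v \<bullet> b) *\<^sub>R b) f x"
    by (simp add: euclidean_representation)
  also have "\<dots> = (\<Sum>b\<in>Basis. (v \<bullet> b) *\<^sub>R dir_deriv b f x)"
    by (simp only: sum scaleR)
  finally show ?thesis .
qed

lemma smooth_differentiable: "smooth f \<Longrightarrow> f differentiable (at x)"
  unfolding smooth_def using times_cont_differentiable.simps(2) by blast

lemma smooth_dir_deriv: "smooth f \<Longrightarrow> smooth (dir_deriv v f)"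
  unfolding smooth_def dir_deriv_def using times_cont_differentiable.simps(2) by blast

lemma smooth_continuous_on: "smooth f \<Longrightarrow> continuous_on S f"
  unfolding smooth_def by (metis continuous_on_subset times_cont_differentiable.simps(1) subset_UNIV)

lemma smooth_has_derivative:
  "smooth f \<Longrightarrow> (f has_derivative (\<lambda>v. dir_deriv v f x)) (at x)"
  by (intro has_derivative_dir_deriv smooth_differentiable)

lemma smooth_borel_measurable:
  fixes f :: "'a::euclidean_space \<Rightarrow> 'b::real_normed_vector"
  shows "smooth f \<Longrightarrow> f \<in> borel_measurable borel"
  by (intro borel_measurable_continuous_onI smooth_continuous_on)

lemma times_cont_differentiable_bounded_linear:
  assumes "bounded_linear L" "times_cont_differentiable k f"
  shows "times_cont_differentiable k (\<lambda>x. L (f x))"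
  using assms(2)
proof (induction k arbitrary: f)
  case 0
  then show ?case
    by (auto intro: continuous_on_compose2[OF linear_continuous_on[OF assms(1)]])
next
  case (Suc k)
  have der: "((\<lambda>x. L (f x)) has_derivative (\<lambda>v. L (dir_deriv v f x))) (at x)" for x
    using Suc.prems by (intro bounded_linear.has_derivative[OF assms(1)] has_derivative_dir_deriv) auto
  have "times_cont_differentiable k (\<lambda>x. L (dir_deriv v f x))" for v
    using Suc by (simp add: dir_deriv_def)
  then show ?case
    using der by (auto simp: differentiable_def simp flip: frechet_derivative_at[OF der])
qed

lemma times_cont_differentiable_add:
  assumes "times_cont_differentiable k f" "times_cont_differentiable k g"
  shows "times_cont_differentiable k (\<lambda>x. f x + g x)"
  using assms
proof (induction k arbitrary: f g)
  case 0
  then show ?case by (auto intro: continuous_on_add)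
next
  case (Suc k)
  have der: "((\<lambda>x. f x + g x) has_derivative (\<lambda>v. dir_deriv v f x + dir_deriv v g x)) (at x)" for x
    using Suc.prems by (intro has_derivative_add has_derivative_dir_deriv) auto
  have "times_cont_differentiable k (\<lambda>x. dir_deriv v f x + dir_deriv v g x)" for v
    using Suc by (simp add: dir_deriv_def)
  then show ?case
    using der by (auto simp: differentiable_def simp flip: frechet_derivative_at[OF der])
qed

lemma times_cont_differentiable_const: "times_cont_differentiable k (\<lambda>x. c)"
proof (induction k arbitrary: c)
  case (Suc k)
  then show ?case by (simp add: frechet_derivative_const)
qed auto

lemma times_cont_differentiable_sum:
  "finite I \<Longrightarrow> (\<And>i. i \<in> I \<Longrightarrow> times_cont_differentiable k (f i)) \<Longrightarrow>
    times_cont_differentiable k (\<lambda>x. \<Sum>i\<in>I. f i x)"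
  by (induction I rule: finite_induct)
    (auto simp: times_cont_differentiable_const intro: times_cont_differentiable_add)

lemma smooth_const: "smooth (\<lambda>x. c)"
  by (simp add: smooth_def times_cont_differentiable_const)

lemma smooth_add: "smooth f \<Longrightarrow> smooth g \<Longrightarrow> smooth (\<lambda>x. f x + g x)"
  by (simp add: smooth_def times_cont_differentiable_add)

lemma smooth_sum: "finite I \<Longrightarrow> (\<And>i. i \<in> I \<Longrightarrow> smooth (f i)) \<Longrightarrow> smooth (\<lambda>x. \<Sum>i\<in>I. f i x)"
  by (simp add: smooth_def times_cont_differentiable_sum)

lemma smooth_bounded_linear: "bounded_linear L \<Longrightarrow> smooth f \<Longrightarrow> smooth (\<lambda>x. L (f x))"
  by (simp add: smooth_def times_cont_differentiable_bounded_linear)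

lemma smooth_cmult:
  fixes f :: "'a::euclidean_space \<Rightarrow> real"
  shows "smooth f \<Longrightarrow> smooth (\<lambda>x. c * f x)"
  by (rule smooth_bounded_linear[OF bounded_linear_mult_right])

lemma smooth_vec:
  fixes f :: "'n::finite \<Rightarrow> 'a::euclidean_space \<Rightarrow> real"
  assumes "\<And>i. smooth (f i)"
  shows "smooth (\<lambda>x. \<chi> i. f i x)"
proof -
  have "(\<lambda>x. \<chi> i. f i x) = (\<lambda>x. \<Sum>i\<in>UNIV. f i x *\<^sub>R axis i 1)"
    by (simp add: fun_eq_iff vec_eq_iff axis_def if_distrib cong: if_cong)
  moreover have "smooth (\<lambda>x. \<Sum>i\<in>UNIV. f i x *\<^sub>R axis i (1::real))"
    by (intro smooth_sum smooth_bounded_linear[OF bounded_linear_scaleR_left] assms) auto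
  ultimately show ?thesis by simp
qed

lemma smooth_comp_affine:
  assumes A: "bounded_linear A" and f: "smooth f"
  shows "smooth (\<lambda>x. f (A x + c))"
proof -
  have "times_cont_differentiable k (\<lambda>x. f (A x + c))" for k
    using f
  proof (induction k arbitrary: f)
    case 0
    have "continuous_on UNIV (\<lambda>x. A x + c)"
      by (intro continuous_on_add continuous_on_const linear_continuous_on A)
    then show ?case
      using continuous_on_compose2[OF smooth_continuous_on[OF 0, of UNIV]] by simp
  next
    case (Suc k)
    have "((\<lambda>x. f (A x + c)) has_derivative (\<lambda>v. dir_deriv (A v) f (A x + c))) (at x)" for x
    proof -
      have "((\<lambda>x. A x + c) has_derivative A) (at x)"
        using bounded_linear.has_derivative[OF A has_derivative_ident]
        by (auto intro!: derivative_eq_intros)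
      from has_derivative_compose[OF this smooth_has_derivative[OF Suc.prems]]
      show ?thesis .
    qed
    note der = this
    have "times_cont_differentiable k (\<lambda>x. dir_deriv (A v) f (A x + c))" for v
      using Suc by (simp add: smooth_dir_deriv)
    then show ?case
      using der by (auto simp: differentiable_def simp flip: frechet_derivative_at[OF der])
  qed
  then show ?thesis by (simp add: smooth_def)
qed

lemma smooth_mult:
  fixes f g :: "'a::euclidean_space \<Rightarrow> real"
  assumes "smooth f" "smooth g"
  shows "smooth (\<lambda>x. f x * g x)"
proof -
  have "times_cont_differentiable k (\<lambda>x. f x * g x)" for k
    using assms
  proof (induction k arbitrary: f g)
    case 0
    then show ?case by (simp add: continuous_on_mult smooth_continuous_on)
  next
    case (Suc k)
    have der: "((\<lambda>x. f x * g x) has_derivative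
        (\<lambda>v. f x * dir_deriv v g x + dir_deriv v f x * g x)) (at x)" for x
      by (intro has_derivative_mult smooth_has_derivative Suc.prems)
    have "times_cont_differentiable k (\<lambda>x. f x * dir_deriv v g x + dir_deriv v f x * g x)" for v
      using Suc by (intro times_cont_differentiable_add) (auto simp: smooth_dir_deriv)
    then show ?case
      using der by (auto simp: differentiable_def simp flip: frechet_derivative_at[OF der])
  qed
  then show ?thesis by (simp add: smooth_def)
qed

text \<open>
  Smoothness can be checked by a closure argument: it is enough that the function lies in a set of
  differentiable functions that is closed under the derivatives along the coordinate axes only, since
  every other directional derivative is a linear combination of those.  This is how integrals that
  depend on a parameter are shown to be smooth.
\<close>

lemma smooth_coinduct:
  fixes S :: "('a::euclidean_space \<Rightarrow> 'b::real_normed_vector) set"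
  assumes "f \<in> S"
    and diff: "\<And>f x. f \<in> S \<Longrightarrow> f differentiable (at x)"
    and closed: "\<And>f b. f \<in> S \<Longrightarrow> b \<in> Basis \<Longrightarrow> dir_deriv b f \<in> S"
  shows "smooth f"
proof -
  have "times_cont_differentiable k f" for k
    using assms(1)
  proof (induction k arbitrary: f)
    case 0
    then show ?case
      using diff
      by (auto intro!: continuous_at_imp_continuous_on differentiable_imp_continuous_within)
  next
    case (Suc k)
    have "times_cont_differentiable k (\<lambda>x. \<Sum>b\<in>Basis. (v \<bullet> b) *\<^sub>R dir_deriv b f x)" for v
      using Suc closed
      by (intro times_cont_differentiable_sum
          times_cont_differentiable_bounded_linear[OF bounded_linear_scaleR_right]) auto
    then have "times_cont_differentiable k (dir_deriv v f)" for v
      by (simp add: dir_deriv_basis_sum[OF diff[OF Suc.prems], symmetric])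
    then show ?case
      using diff[OF Suc.prems] by (auto simp: dir_deriv_def)
  qed
  then show ?thesis by (simp add: smooth_def)
qed

lemma dir_deriv_along_line:
  fixes f :: "'a::euclidean_space \<Rightarrow> real"
  assumes "f differentiable (at (a + s *\<^sub>R v))"
  shows "((\<lambda>s. f (a + s *\<^sub>R v)) has_real_derivative dir_deriv v f (a + s *\<^sub>R v)) (at s)"
proof -
  interpret bounded_linear "\<lambda>w. dir_deriv w f (a + s *\<^sub>R v)"
    by (rule has_derivative_bounded_linear[OF has_derivative_dir_deriv[OF assms]])
  have "((\<lambda>s. a + s *\<^sub>R v) has_derivative (\<lambda>r. r *\<^sub>R v)) (at s)"
    by (auto intro!: derivative_eq_intros)
  from has_derivative_compose[OF this has_derivative_dir_deriv[OF assms]]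
  show ?thesis
    by (simp add: has_field_derivative_def scaleR mult.commute[of _ "dir_deriv v f _"])
qed

text \<open>
  The mean value theorem, applied first along \<open>u\<close> and then along \<open>v\<close>, identifies the second
  difference with a mixed derivative at a nearby point.  The left-hand side is symmetric in \<open>u\<close> and
  \<open>v\<close>, so the same second difference also yields the derivatives in the opposite order.
\<close>

lemma second_difference_eq:
  fixes f :: "'a::euclidean_space \<Rightarrow> real"
  assumes f: "smooth f" and "s > 0"
  obtains \<xi> where "dist \<xi> x \<le> s * (norm u + norm v)"
    and "f (x + s *\<^sub>R u + s *\<^sub>R v) - f (x + s *\<^sub>R u) - f (x + s *\<^sub>R v) + f x
          = s^2 * dir_deriv v (dir_deriv u f) \<xi>"
proof -
  let ?g = "\<lambda>r. f (x + s *\<^sub>R v + r *\<^sub>R u) - f (x + r *\<^sub>R u)"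
  have "(?g has_real_derivative (dir_deriv u f (x + s *\<^sub>R v + r *\<^sub>R u) - dir_deriv u f (x + r *\<^sub>R u))) (at r)" for r
    by (intro DERIV_diff dir_deriv_along_line smooth_differentiable f)
  from MVT2[OF \<open>s > 0\<close> this]
  obtain a where a: "0 < a" "a < s" "?g s - ?g 0 =
      s * (dir_deriv u f (x + s *\<^sub>R v + a *\<^sub>R u) - dir_deriv u f (x + a *\<^sub>R u))"
    by auto
  let ?h = "\<lambda>r. dir_deriv u f (x + a *\<^sub>R u + r *\<^sub>R v)"
  have "(?h has_real_derivative dir_deriv v (dir_deriv u f) (x + a *\<^sub>R u + r *\<^sub>R v)) (at r)" for r
    by (intro dir_deriv_along_line smooth_differentiable smooth_dir_deriv f)
  from MVT2[OF \<open>s > 0\<close> this]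
  obtain b where b: "0 < b" "b < s"
      "?h s - ?h 0 = s * dir_deriv v (dir_deriv u f) (x + a *\<^sub>R u + b *\<^sub>R v)"
    by auto
  show thesis
  proof
    have "dist (x + a *\<^sub>R u + b *\<^sub>R v) x = norm (a *\<^sub>R u + b *\<^sub>R v)"
      by (simp add: dist_norm algebra_simps)
    also have "\<dots> \<le> norm (a *\<^sub>R u) + norm (b *\<^sub>R v)" by (rule norm_triangle_ineq)
    also have "\<dots> \<le> s * norm u + s * norm v"
      using a b by (auto intro!: add_mono mult_right_mono)
    finally show "dist (x + a *\<^sub>R u + b *\<^sub>R v) x \<le> s * (norm u + norm v)"
      by (simp add: algebra_simps)
    show "f (x + s *\<^sub>R u + s *\<^sub>R v) - f (x + s *\<^sub>R u) - f (x + s *\<^sub>R v) + f x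
          = s^2 * dir_deriv v (dir_deriv u f) (x + a *\<^sub>R u + b *\<^sub>R v)"
      using a(3) b(3) by (simp add: algebra_simps power2_eq_square)
  qed
qed

text \<open>
  Symmetry of second derivatives: divide the second difference by the square of the step and let
  the step tend to zero, once for each order of differentiation.
\<close>

lemma dir_deriv_commute:
  fixes f :: "'a::euclidean_space \<Rightarrow> real"
  assumes f: "smooth f"
  shows "dir_deriv u (dir_deriv v f) = dir_deriv v (dir_deriv u f)"
proof
  fix x
  define s where "s n = inverse (real (Suc n))" for n
  have s: "s n > 0" for n by (simp add: s_def)
  have s0: "(\<lambda>n. s n * c) \<longlonglongrightarrow> 0" for c
    unfolding s_def by (intro tendsto_mult_left_zero LIMSEQ_inverse_real_of_nat)
  let ?D = "\<lambda>n. f (x + s n *\<^sub>R u + s n *\<^sub>R v) - f (x + s n *\<^sub>R u) - f (x + s n *\<^sub>R v) + f x"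
  have lim: "(\<lambda>n. D n / (s n)^2) \<longlonglongrightarrow> dir_deriv q (dir_deriv p f) x"
    if D: "\<And>n. \<exists>\<xi>. dist \<xi> x \<le> s n * (norm p + norm q) \<and> D n = (s n)^2 * dir_deriv q (dir_deriv p f) \<xi>"
    for D p q
  proof -
    obtain \<xi> where \<xi>: "\<And>n. dist (\<xi> n) x \<le> s n * (norm p + norm q)"
      "\<And>n. D n = (s n)^2 * dir_deriv q (dir_deriv p f) (\<xi> n)"
      using choice[of "\<lambda>n \<xi>. dist \<xi> x \<le> s n * (norm p + norm q) \<and> D n = (s n)^2 * dir_deriv q (dir_deriv p f) \<xi>"] D
      by blast
    have "(\<lambda>n. dist (\<xi> n) x) \<longlonglongrightarrow> 0"
      by (rule tendsto_sandwich[OF _ _ tendsto_const s0[of "norm p + norm q"]])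
        (use \<xi>(1) in \<open>auto intro!: always_eventually\<close>)
    then have "\<xi> \<longlonglongrightarrow> x" by (rule tendsto_dist_iff[THEN iffD2])
    then have "(\<lambda>n. dir_deriv q (dir_deriv p f) (\<xi> n)) \<longlonglongrightarrow> dir_deriv q (dir_deriv p f) x"
      by (rule continuous_on_tendsto_compose[OF
            smooth_continuous_on[OF smooth_dir_deriv[OF smooth_dir_deriv[OF f]], of UNIV]]) auto
    moreover have "D n / (s n)^2 = dir_deriv q (dir_deriv p f) (\<xi> n)" for n
      using s[of n] \<xi>(2)[of n] by simp
    ultimately show ?thesis by simp
  qed
  have "(\<lambda>n. ?D n / (s n)^2) \<longlonglongrightarrow> dir_deriv v (dir_deriv u f) x"
  proof (rule lim)
    fix n
    show "\<exists>\<xi>. dist \<xi> x \<le> s n * (norm u + norm v) \<and> ?D n = (s n)^2 * dir_deriv v (dir_deriv u f) \<xi>"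
      by (rule second_difference_eq[OF f s, where x=x and u=u and v=v]) blast
  qed
  moreover have "(\<lambda>n. ?D n / (s n)^2) \<longlonglongrightarrow> dir_deriv u (dir_deriv v f) x"
  proof (rule lim)
    fix n
    obtain \<xi> where "dist \<xi> x \<le> s n * (norm v + norm u)"
      "f (x + s n *\<^sub>R v + s n *\<^sub>R u) - f (x + s n *\<^sub>R v) - f (x + s n *\<^sub>R u) + f x
        = (s n)^2 * dir_deriv u (dir_deriv v f) \<xi>"
      by (rule second_difference_eq[OF f s, where x=x and u=v and v=u])
    then show "\<exists>\<xi>. dist \<xi> x \<le> s n * (norm v + norm u) \<and> ?D n = (s n)^2 * dir_deriv u (dir_deriv v f) \<xi>"
      by (intro exI[of _ \<xi>]) (auto simp: algebra_simps)
  qed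
  ultimately show "dir_deriv u (dir_deriv v f) x = dir_deriv v (dir_deriv u f) x"
    using LIMSEQ_unique by blast
qed

section \<open>Differentiation under the integral sign\<close>

text \<open>
  An integrable bound that is uniform on the unit ball around each parameter value; together with
  the same property of the derivatives this is what dominated convergence needs locally.
\<close>

definition dominated_family :: "'w measure \<Rightarrow> ('w \<Rightarrow> 'a::euclidean_space \<Rightarrow> real) \<Rightarrow> bool" where
  "dominated_family M G \<longleftrightarrow>
     (\<forall>x. (\<lambda>\<omega>. G \<omega> x) \<in> borel_measurable M) \<and>
     (\<forall>x. \<exists>h. integrable M h \<and> (\<forall>\<omega>. \<forall>y\<in>ball x 1. \<bar>G \<omega> y\<bar> \<le> h \<omega>))"

lemma dominated_family_integrable:
  assumes "dominated_family M G"
  shows "integrable M (\<lambda>\<omega>. G \<omega> x)"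
proof -
  obtain h where h: "integrable M h" "\<And>\<omega> y. y \<in> ball x 1 \<Longrightarrow> \<bar>G \<omega> y\<bar> \<le> h \<omega>"
    using assms unfolding dominated_family_def by metis
  have "\<bar>G \<omega> x\<bar> \<le> h \<omega>" for \<omega> by (rule h(2)) simp
  then have "AE \<omega> in M. norm (G \<omega> x) \<le> norm (h \<omega>)"
    by (intro AE_I2) (metis abs_ge_self order_trans real_norm_def)
  moreover have "(\<lambda>\<omega>. G \<omega> x) \<in> borel_measurable M"
    using assms by (simp add: dominated_family_def)
  ultimately show ?thesis
    using Bochner_Integration.integrable_bound[OF h(1)] by blast
qed

text \<open>
  The derivatives along the coordinate axes have an integrable bound near \<open>x\<close>, and hence so do the
  difference quotients, by the mean value inequality.  The remainder of the linear approximation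
  therefore tends to zero under the integral, by dominated convergence along every sequence.
\<close>

lemma has_derivative_integral_dominated:
  fixes G :: "'w \<Rightarrow> 'a::euclidean_space \<Rightarrow> real"
  assumes diff: "\<And>\<omega> x. G \<omega> differentiable (at x)"
    and dom: "dominated_family M G"
    and dom': "\<And>b. b \<in> Basis \<Longrightarrow> dominated_family M (\<lambda>\<omega>. dir_deriv b (G \<omega>))"
  shows "((\<lambda>x. \<integral>\<omega>. G \<omega> x \<partial>M) has_derivative (\<lambda>v. \<integral>\<omega>. dir_deriv v (G \<omega>) x \<partial>M)) (at x)"
proof -
  obtain h where h: "\<And>b. b \<in> Basis \<Longrightarrow> integrable M (h b)"
    "\<And>b \<omega> y. b \<in> Basis \<Longrightarrow> y \<in> ball x 1 \<Longrightarrow> \<bar>dir_deriv b (G \<omega>) y\<bar> \<le> h b \<omega>"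
  proof -
    have "\<forall>b\<in>Basis. \<exists>h. integrable M h \<and> (\<forall>\<omega>. \<forall>y\<in>ball x 1. \<bar>dir_deriv b (G \<omega>) y\<bar> \<le> h \<omega>)"
      using dom' unfolding dominated_family_def by simp
    from bchoice[OF this] show ?thesis using that by blast
  qed
  define H where "H = (\<lambda>\<omega>. \<Sum>b\<in>Basis. h b \<omega>)"
  have H_int: "integrable M H"
    unfolding H_def using h(1) by (intro Bochner_Integration.integrable_sum) auto
  define D where "D b \<omega> y = dir_deriv b (G \<omega>) y" for b \<omega> y
  have expand: "dir_deriv v (G \<omega>) y = (\<Sum>b\<in>Basis. (v \<bullet> b) * D b \<omega> y)" for v \<omega> y
    using dir_deriv_basis_sum[OF diff, of v \<omega> y] by (simp add: D_def)
  have bound: "\<bar>dir_deriv v (G \<omega>) y\<bar> \<le> H \<omega> * norm v" if "y \<in> ball x 1" for v \<omega> y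
  proof -
    have "\<bar>dir_deriv v (G \<omega>) y\<bar> \<le> (\<Sum>b\<in>Basis. \<bar>(v \<bullet> b) * D b \<omega> y\<bar>)"
      unfolding expand by (rule sum_abs)
    also have "\<dots> \<le> (\<Sum>b\<in>Basis. norm v * h b \<omega>)"
      unfolding abs_mult D_def using h(2)[OF _ that]
      by (intro sum_mono mult_mono) (auto simp: Basis_le_norm)
    finally show ?thesis by (simp add: H_def sum_distrib_left mult.commute)
  qed
  have int': "integrable M (\<lambda>\<omega>. D b \<omega> x)" if "b \<in> Basis" for b
    unfolding D_def by (rule dominated_family_integrable[OF dom'[OF that]])
  have int_dir: "integrable M (\<lambda>\<omega>. dir_deriv v (G \<omega>) x)" for v
    unfolding expand using int' by (intro Bochner_Integration.integrable_sum integrable_mult_right) auto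
  have int: "integrable M (\<lambda>\<omega>. G \<omega> y)" for y
    by (rule dominated_family_integrable[OF dom])
  have linear: "bounded_linear (\<lambda>v. \<integral>\<omega>. dir_deriv v (G \<omega>) x \<partial>M)"
  proof -
    have "(\<integral>\<omega>. dir_deriv v (G \<omega>) x \<partial>M) = (\<Sum>b\<in>Basis. (v \<bullet> b) * (\<integral>\<omega>. D b \<omega> x \<partial>M))" for v
      unfolding expand using int' by (subst Bochner_Integration.integral_sum) auto
    then show ?thesis
      by (auto intro!: bounded_linear_sum bounded_linear_mult_const bounded_linear_inner_left)
  qed
  let ?q = "\<lambda>y \<omega>. (G \<omega> y - G \<omega> x - dir_deriv (y - x) (G \<omega>) x) / norm (y - x)"
  have q_bound: "\<bar>?q y \<omega>\<bar> \<le> 2 * H \<omega>" if y: "y \<in> ball x 1" "y \<noteq> x" for y \<omega>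
  proof -
    have "norm (G \<omega> y - G \<omega> x) \<le> H \<omega> * norm (y - x)"
    proof (rule differentiable_bound[of "ball x 1"])
      fix z assume z: "z \<in> ball x 1"
      show "(G \<omega> has_derivative (\<lambda>v. dir_deriv v (G \<omega>) z)) (at z within ball x 1)"
        by (rule has_derivative_at_withinI[OF has_derivative_dir_deriv[OF diff]])
      show "onorm (\<lambda>v. dir_deriv v (G \<omega>) z) \<le> H \<omega>"
        by (rule onorm_le) (use bound[OF z] in simp)
    qed (use y in auto)
    moreover have "\<bar>dir_deriv (y - x) (G \<omega>) x\<bar> \<le> H \<omega> * norm (y - x)"
      by (rule bound) simp
    ultimately have "\<bar>G \<omega> y - G \<omega> x - dir_deriv (y - x) (G \<omega>) x\<bar> \<le> 2 * H \<omega> * norm (y - x)"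
      by simp
    then show ?thesis using y by (simp add: divide_le_eq)
  qed
  have q_lim: "((\<lambda>y. ?q y \<omega>) \<longlongrightarrow> 0) (at x)" for \<omega>
    using has_derivative_dir_deriv[OF diff[of \<omega> x]]
    unfolding has_derivative_iff_norm tendsto_norm_zero_iff[symmetric, of "\<lambda>y. ?q y \<omega>"]
    by (simp add: abs_mult)
  have q_int: "integrable M (?q y)" for y
    using int int_dir by (intro integrable_divide Bochner_Integration.integrable_diff) auto
  have "((\<lambda>y. \<integral>\<omega>. ?q y \<omega> \<partial>M) \<longlongrightarrow> 0) (at x)"
    unfolding tendsto_at_iff_sequentially
  proof (intro allI impI)
    fix X :: "nat \<Rightarrow> 'a"
    assume X: "\<forall>n. X n \<in> UNIV - {x}" "X \<longlonglongrightarrow> x"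
    \<comment> \<open>The bound holds on the unit ball only, so the first terms of the sequence are dropped.\<close>
    obtain N where N: "\<And>n. n \<ge> N \<Longrightarrow> dist (X n) x < 1"
      using X(2)[THEN metric_LIMSEQ_D, of 1] by auto
    have near: "X (n + N) \<in> ball x 1" "X (n + N) \<noteq> x" for n
      using N[of "n + N"] X(1) by (auto simp: dist_commute)
    have "(\<lambda>n. \<integral>\<omega>. ?q (X (n + N)) \<omega> \<partial>M) \<longlonglongrightarrow> (\<integral>\<omega>. 0 \<partial>M)"
    proof (rule integral_dominated_convergence)
      show "integrable M (\<lambda>\<omega>. 2 * H \<omega>)" using H_int by simp
      show "AE \<omega> in M. (\<lambda>n. ?q (X (n + N)) \<omega>) \<longlonglongrightarrow> 0"
      proof (rule AE_I2)
        fix \<omega>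
        have "((\<lambda>y. ?q y \<omega>) \<circ> X) \<longlonglongrightarrow> 0"
          using q_lim[of \<omega>] X unfolding tendsto_at_iff_sequentially by blast
        from LIMSEQ_ignore_initial_segment[OF this, of N]
        show "(\<lambda>n. ?q (X (n + N)) \<omega>) \<longlonglongrightarrow> 0" by (simp add: o_def)
      qed
      show "AE \<omega> in M. norm (?q (X (n + N)) \<omega>) \<le> 2 * H \<omega>" for n
        using q_bound[OF near(1) near(2)] by (intro AE_I2) simp
      show "?q (X (n + N)) \<in> borel_measurable M" for n
        by (rule borel_measurable_integrable[OF q_int])
    qed simp
    then have "(\<lambda>n. ((\<lambda>y. \<integral>\<omega>. ?q y \<omega> \<partial>M) \<circ> X) (n + N)) \<longlonglongrightarrow> 0"
      by (simp add: o_def)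
    then show "((\<lambda>y. \<integral>\<omega>. ?q y \<omega> \<partial>M) \<circ> X) \<longlonglongrightarrow> 0"
      by (rule LIMSEQ_offset)
  qed
  then have lim: "((\<lambda>y. \<bar>\<integral>\<omega>. ?q y \<omega> \<partial>M\<bar>) \<longlongrightarrow> 0) (at x)"
    by (rule tendsto_rabs_zero)
  have eq: "\<bar>\<integral>\<omega>. ?q y \<omega> \<partial>M\<bar> = norm ((\<integral>\<omega>. G \<omega> y \<partial>M) - (\<integral>\<omega>. G \<omega> x \<partial>M)
      - (\<integral>\<omega>. dir_deriv (y - x) (G \<omega>) x \<partial>M)) / norm (y - x)" for y
    using int int_dir by (simp add: abs_divide)
  from lim show ?thesis
    unfolding has_derivative_iff_norm eq by (intro conjI linear)
qed

lemma dir_deriv_integral: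
  fixes G :: "'w \<Rightarrow> 'a::euclidean_space \<Rightarrow> real"
  assumes "\<And>\<omega> x. G \<omega> differentiable (at x)" "dominated_family M G"
    and "\<And>b. b \<in> Basis \<Longrightarrow> dominated_family M (\<lambda>\<omega>. dir_deriv b (G \<omega>))"
  shows "dir_deriv v (\<lambda>x. \<integral>\<omega>. G \<omega> x \<partial>M) = (\<lambda>x. \<integral>\<omega>. dir_deriv v (G \<omega>) x \<partial>M)"
  using dir_deriv_eqI[OF has_derivative_integral_dominated[OF assms]] by (intro ext) simp

lemma smooth_integral:
  fixes \<G> :: "('w \<Rightarrow> 'a::euclidean_space \<Rightarrow> real) set"
  assumes "G \<in> \<G>"
    and diff: "\<And>G \<omega> x. G \<in> \<G> \<Longrightarrow> G \<omega> differentiable (at x)"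
    and dom: "\<And>G. G \<in> \<G> \<Longrightarrow> dominated_family M G"
    and closed: "\<And>G b. G \<in> \<G> \<Longrightarrow> b \<in> Basis \<Longrightarrow> (\<lambda>\<omega>. dir_deriv b (G \<omega>)) \<in> \<G>"
  shows "smooth (\<lambda>x. \<integral>\<omega>. G \<omega> x \<partial>M)"
proof (rule smooth_coinduct)
  show "(\<lambda>x. \<integral>\<omega>. G \<omega> x \<partial>M) \<in> (\<lambda>G x. \<integral>\<omega>. G \<omega> x \<partial>M) ` \<G>"
    using assms(1) by blast
next
  fix F x assume "F \<in> (\<lambda>G x. \<integral>\<omega>. G \<omega> x \<partial>M) ` \<G>"
  then obtain G where G: "G \<in> \<G>" "F = (\<lambda>x. \<integral>\<omega>. G \<omega> x \<partial>M)" by blast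
  show "F differentiable (at x)"
    unfolding G(2) using has_derivative_integral_dominated[of G M x] diff dom closed G(1)
    by (auto simp: differentiable_def)
  fix b :: 'a assume "b \<in> Basis"
  then show "dir_deriv b F \<in> (\<lambda>G x. \<integral>\<omega>. G \<omega> x \<partial>M) ` \<G>"
    unfolding G(2) using G(1) diff dom closed
    by (subst dir_deriv_integral) auto
qed

section \<open>Antiderivatives in time\<close>

text \<open>
  The antiderivative of \<open>F\<close> in time is \<open>t \<integral>\<^sub>0\<^sup>1 F (x, u t) du\<close>.  On the fixed interval \<open>{0..1}\<close>
  the sign of \<open>t\<close> causes no case distinction.  A time derivative of the integrand produces a factor
  \<open>u\<close>; the powers \<open>u ^ n\<close> make the family closed under differentiation.
\<close>

definition time_moment_family ::
    "nat \<Rightarrow> ('a::euclidean_space \<times> real \<Rightarrow> real) \<Rightarrow> real \<Rightarrow> 'a \<times> real \<Rightarrow> real" where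
  "time_moment_family n F = (\<lambda>u z. u ^ n * F (fst z, u * snd z) * indicator {0..1} u)"

definition time_moment ::
    "nat \<Rightarrow> ('a::euclidean_space \<times> real \<Rightarrow> real) \<Rightarrow> 'a \<times> real \<Rightarrow> real" where
  "time_moment n F z = (\<integral>u. time_moment_family n F u z \<partial>lborel)"

definition time_antideriv ::
    "('a::euclidean_space \<times> real \<Rightarrow> real) \<Rightarrow> 'a \<times> real \<Rightarrow> real" where
  "time_antideriv F z = snd z * time_moment 0 F z"

lemma has_derivative_time_moment_family:
  assumes "smooth F"
  shows "(time_moment_family n F u has_derivative
    (\<lambda>v. u ^ n * dir_deriv (fst v, u * snd v) F (fst z, u * snd z) * indicator {0..1} u)) (at z)"
proof -
  have "((\<lambda>z. (fst z, u * snd z)) has_derivative (\<lambda>v. (fst v, u * snd v))) (at z)"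
    by (auto intro!: derivative_eq_intros)
  from has_derivative_compose[OF this smooth_has_derivative[OF assms]]
  show ?thesis
    unfolding time_moment_family_def
    by (intro has_derivative_mult_left has_derivative_mult_right)
qed

text \<open>
  For \<open>u\<close> in \<open>{0..1}\<close> the point \<open>(x, u t)\<close> stays in a fixed ball while \<open>(x, t)\<close> ranges over a
  bounded set, and \<open>F\<close> is bounded there by compactness.
\<close>

lemma dominated_time_moment_family:
  fixes F :: "'a::euclidean_space \<times> real \<Rightarrow> real"
  assumes F: "smooth F"
  shows "dominated_family lborel (time_moment_family n F)"
  unfolding dominated_family_def
proof (intro conjI allI)
  fix z :: "'a \<times> real"
  have "continuous_on UNIV (\<lambda>u. u ^ n * F (fst z, u * snd z))"
    by (intro continuous_intros continuous_on_compose2[OF smooth_continuous_on[OF F, of UNIV]]) auto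
  from borel_measurable_continuous_onI[OF this]
  show "(\<lambda>u. time_moment_family n F u z) \<in> borel_measurable lborel"
    unfolding time_moment_family_def by measurable
  have "compact (F ` cball 0 (norm z + 1))"
    by (intro compact_continuous_image smooth_continuous_on F compact_cball)
  then have "bounded (F ` cball 0 (norm z + 1))" by (rule compact_imp_bounded)
  then obtain B where "\<forall>y\<in>cball 0 (norm z + 1). \<bar>F y\<bar> \<le> B"
    unfolding bounded_iff by auto
  then have B: "\<bar>F y\<bar> \<le> B" if "norm y \<le> norm z + 1" for y
    using that by auto
  show "\<exists>h. integrable lborel h \<and> (\<forall>u. \<forall>y\<in>ball z 1. \<bar>time_moment_family n F u y\<bar> \<le> h u)"
  proof (intro exI conjI allI ballI)
    show "integrable lborel (\<lambda>u::real. B * indicator {0..1} u)" by simp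
    fix u and y :: "'a \<times> real" assume y: "y \<in> ball z 1"
    show "\<bar>time_moment_family n F u y\<bar> \<le> B * indicator {0..1} u"
    proof (cases "u \<in> {0..1}")
      case True
      then have u: "0 \<le> u" "u \<le> 1" by auto
      have "norm y \<le> norm z + 1"
        using y norm_triangle_ineq2[of y z] by (simp add: dist_norm norm_minus_commute)
      moreover have "norm (fst y, u * snd y) \<le> norm y"
      proof -
        have "\<bar>u * snd y\<bar> \<le> \<bar>snd y\<bar>" using u by (simp add: abs_mult mult_left_le_one_le)
        then have "norm (u * snd y)^2 \<le> norm (snd y)^2" by (intro power_mono) auto
        then show ?thesis by (simp add: norm_prod_def)
      qed
      ultimately have "\<bar>F (fst y, u * snd y)\<bar> \<le> B" by (intro B) simp
      moreover have "\<bar>u ^ n\<bar> \<le> 1" using u by (simp add: power_le_one)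
      ultimately have "\<bar>u ^ n\<bar> * \<bar>F (fst y, u * snd y)\<bar> \<le> 1 * B"
        by (intro mult_mono) auto
      then show ?thesis using True by (simp add: time_moment_family_def abs_mult)
    qed (simp add: time_moment_family_def)
  qed
qed

lemma dir_deriv_time_moment_family_space:
  assumes "smooth F"
  shows "dir_deriv (w, 0) (time_moment_family n F u) = time_moment_family n (dir_deriv (w, 0) F) u"
  by (intro ext dir_deriv_eqI[OF has_derivative_time_moment_family[OF assms], THEN trans])
    (simp add: time_moment_family_def)

lemma dir_deriv_time_moment_family_time:
  assumes "smooth F"
  shows "dir_deriv (0, 1) (time_moment_family n F u) = time_moment_family (Suc n) (dir_deriv (0, 1) F) u"
proof
  fix z
  interpret bounded_linear "\<lambda>v. dir_deriv v F (fst z, u * snd z)"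
    by (rule has_derivative_bounded_linear[OF smooth_has_derivative[OF assms]])
  have "dir_deriv (0, u) F (fst z, u * snd z) = u * dir_deriv (0, 1) F (fst z, u * snd z)"
    using scaleR[of u "(0, 1)"] by (simp add: zero_prod_def)
  then show "dir_deriv (0, 1) (time_moment_family n F u) z
      = time_moment_family (Suc n) (dir_deriv (0, 1) F) u z"
    unfolding dir_deriv_eqI[OF has_derivative_time_moment_family[OF assms]]
    by (simp add: time_moment_family_def)
qed

lemma dominated_dir_deriv_time_moment_family:
  fixes F :: "'a::euclidean_space \<times> real \<Rightarrow> real"
  assumes "smooth F" "b \<in> Basis"
  shows "dominated_family lborel (\<lambda>u. dir_deriv b (time_moment_family n F u))"
  using assms(2)
  by (auto simp: Basis_prod_def dir_deriv_time_moment_family_space dir_deriv_time_moment_family_time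
      assms(1) eta_contract_eq intro!: dominated_time_moment_family smooth_dir_deriv)

lemma time_moment_family_differentiable:
  "smooth F \<Longrightarrow> time_moment_family n F u differentiable (at z)"
  unfolding differentiable_def by (rule exI, rule has_derivative_time_moment_family)

lemma dir_deriv_time_moment:
  fixes F :: "'a::euclidean_space \<times> real \<Rightarrow> real"
  assumes F: "smooth F"
  shows "dir_deriv (w, 0) (time_moment n F) = time_moment n (dir_deriv (w, 0) F)"
    and "dir_deriv (0, 1) (time_moment n F) = time_moment (Suc n) (dir_deriv (0, 1) F)"
  unfolding time_moment_def[abs_def]
  by (simp_all add: dir_deriv_integral[OF time_moment_family_differentiable[OF F]
        dominated_time_moment_family[OF F] dominated_dir_deriv_time_moment_family[OF F]]
      dir_deriv_time_moment_family_space[OF F] dir_deriv_time_moment_family_time[OF F])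

lemma smooth_time_moment:
  fixes F :: "'a::euclidean_space \<times> real \<Rightarrow> real"
  assumes F: "smooth F"
  shows "smooth (time_moment n F)"
  unfolding time_moment_def[abs_def]
proof (rule smooth_integral)
  let ?S = "{time_moment_family n F |n (F :: 'a \<times> real \<Rightarrow> real). smooth F}"
  show "time_moment_family n F \<in> ?S" using F by blast
  fix G assume "G \<in> ?S"
  then obtain m H where G: "G = time_moment_family m H" "smooth H" by blast
  show "G u differentiable (at z)" for u z
    unfolding G(1) by (rule time_moment_family_differentiable[OF G(2)])
  show "dominated_family lborel G"
    unfolding G(1) by (rule dominated_time_moment_family[OF G(2)])
  show "(\<lambda>u. dir_deriv b (G u)) \<in> ?S" if "b \<in> Basis" for b
    using that smooth_dir_deriv[OF G(2)]
    by (auto 0 0 simp: G Basis_prod_def dir_deriv_time_moment_family_space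
        dir_deriv_time_moment_family_time fun_eq_iff) blast+
qed

lemma smooth_time_antideriv:
  fixes F :: "'a::euclidean_space \<times> real \<Rightarrow> real"
  assumes F: "smooth F"
  shows "smooth (time_antideriv F)"
proof -
  have "smooth (\<lambda>z::'a \<times> real. snd z)"
  proof (rule smooth_coinduct[of _ "insert (\<lambda>z. snd z) (range (\<lambda>c z. c))"])
    fix f :: "'a \<times> real \<Rightarrow> real" and b :: "'a \<times> real"
    assume "f \<in> insert (\<lambda>z. snd z) (range (\<lambda>c z. c))"
    moreover have "dir_deriv b snd = (\<lambda>z::'a \<times> real. snd b)"
      by (intro ext dir_deriv_eqI[OF has_derivative_snd[OF has_derivative_ident]])
    moreover have "dir_deriv b (\<lambda>z::'a \<times> real. c) = (\<lambda>z. 0::real)" for c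
      by (simp add: dir_deriv_def frechet_derivative_const)
    ultimately show "dir_deriv b f \<in> insert (\<lambda>z. snd z) (range (\<lambda>c z. c))"
      by (auto simp: eta_contract_eq)
  qed (auto intro: bounded_linear_imp_differentiable bounded_linear_snd differentiable_const)
  then show ?thesis
    unfolding time_antideriv_def[abs_def] by (intro smooth_mult smooth_time_moment F)
qed

lemma has_derivative_time_antideriv:
  fixes F :: "'a::euclidean_space \<times> real \<Rightarrow> real"
  assumes F: "smooth F"
  shows "(time_antideriv F has_derivative
    (\<lambda>v. snd z * dir_deriv v (time_moment 0 F) z + snd v * time_moment 0 F z)) (at z)"
  unfolding time_antideriv_def[abs_def]
  by (intro has_derivative_mult has_derivative_snd has_derivative_ident
      smooth_has_derivative smooth_time_moment F)

lemma space_deriv_time_antideriv: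
  fixes F :: "'a::euclidean_space \<times> real \<Rightarrow> real"
  assumes F: "smooth F"
  shows "dir_deriv (w, 0) (time_antideriv F) = time_antideriv (dir_deriv (w, 0) F)"
  by (intro ext dir_deriv_eqI[OF has_derivative_time_antideriv[OF F], THEN trans])
    (simp add: dir_deriv_time_moment[OF F] time_antideriv_def)

lemma time_profile_has_derivative:
  fixes F :: "'a::euclidean_space \<times> real \<Rightarrow> real"
  assumes F: "smooth F"
  shows "((\<lambda>u. F (x, u * t)) has_real_derivative t * dir_deriv (0, 1) F (x, u * t)) (at u)"
proof -
  interpret bounded_linear "\<lambda>v. dir_deriv v F (x, u * t)"
    by (rule has_derivative_bounded_linear[OF smooth_has_derivative[OF F]])
  have "((\<lambda>u. F ((x, 0) + u *\<^sub>R (0, t))) has_real_derivative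
      dir_deriv (0, t) F ((x, 0) + u *\<^sub>R (0, t))) (at u)"
    by (intro dir_deriv_along_line smooth_differentiable F)
  moreover have "dir_deriv (0, t) F (x, u * t) = t * dir_deriv (0, 1) F (x, u * t)"
    using scaleR[of t "(0, 1)"] by (simp add: zero_prod_def)
  ultimately show ?thesis by simp
qed

lemma isCont_time_profile:
  fixes F :: "'a::euclidean_space \<times> real \<Rightarrow> real"
  assumes "smooth F"
  shows "isCont (\<lambda>u. F (x, u * t)) u"
  by (rule DERIV_isCont[OF time_profile_has_derivative[OF assms]])

text \<open>
  The time derivative of \<open>t \<integral>\<^sub>0\<^sup>1 F (x, u t) du\<close> is the integral of the derivative of
  \<open>u F (x, u t)\<close> with respect to \<open>u\<close>.
\<close>

lemma time_deriv_time_antideriv: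
  fixes F :: "'a::euclidean_space \<times> real \<Rightarrow> real"
  assumes F: "smooth F"
  shows "dir_deriv (0, 1) (time_antideriv F) = F"
proof
  fix z :: "'a \<times> real"
  obtain x t where z: "z = (x, t)" by (cases z)
  let ?F' = "dir_deriv (0, 1) F"
  have int: "integrable lborel (\<lambda>u. time_moment_family n G u z)" if "smooth G" for n G
    by (rule dominated_family_integrable[OF dominated_time_moment_family[OF that]])
  have "dir_deriv (0, 1) (time_antideriv F) z
      = t * time_moment (Suc 0) ?F' z + time_moment 0 F z"
    by (simp add: dir_deriv_eqI[OF has_derivative_time_antideriv[OF F]] dir_deriv_time_moment[OF F] z)
  also have "\<dots> = (\<integral>u. t * time_moment_family (Suc 0) ?F' u z + time_moment_family 0 F u z \<partial>lborel)"
    using int[OF F] int[OF smooth_dir_deriv[OF F]] by (simp add: time_moment_def)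
  also have "\<dots> = (\<integral>u. (u * (t * ?F' (x, u * t)) + 1 * F (x, u * t)) * indicator {0..1} u \<partial>lborel)"
    by (intro Bochner_Integration.integral_cong) (auto simp: time_moment_family_def z algebra_simps)
  also have "\<dots> = 1 * F (x, 1 * t) - 0 * F (x, 0 * t)"
  proof (rule integral_FTC_Icc_real)
    fix u :: real
    show "((\<lambda>u. u * F (x, u * t)) has_real_derivative u * (t * ?F' (x, u * t)) + 1 * F (x, u * t)) (at u)"
      using DERIV_mult[OF DERIV_ident time_profile_has_derivative[OF F, of x t u]]
      by (simp add: algebra_simps)
    show "isCont (\<lambda>u. u * (t * ?F' (x, u * t)) + 1 * F (x, u * t)) u"
      by (intro continuous_intros isCont_time_profile smooth_dir_deriv F)
  qed simp
  finally show "dir_deriv (0, 1) (time_antideriv F) z = F z" by (simp add: z)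
qed

lemma time_antideriv_time_deriv:
  fixes F :: "'a::euclidean_space \<times> real \<Rightarrow> real"
  assumes F: "smooth F"
  shows "time_antideriv (dir_deriv (0, 1) F) (x, t) = F (x, t) - F (x, 0)"
proof -
  let ?F' = "dir_deriv (0, 1) F"
  have "time_antideriv ?F' (x, t) = (\<integral>u. t * ?F' (x, u * t) * indicator {0..1} u \<partial>lborel)"
    by (simp add: time_antideriv_def time_moment_def time_moment_family_def mult.assoc)
  also have "\<dots> = F (x, 1 * t) - F (x, 0 * t)"
  proof (rule integral_FTC_Icc_real)
    fix u :: real
    show "((\<lambda>u. F (x, u * t)) has_real_derivative t * ?F' (x, u * t)) (at u)"
      by (rule time_profile_has_derivative[OF F])
    show "isCont (\<lambda>u. t * ?F' (x, u * t)) u"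
      by (intro continuous_intros isCont_time_profile smooth_dir_deriv F)
  qed simp
  finally show ?thesis by simp
qed

section \<open>Decay and integrability in three dimensions\<close>

text \<open>
  A product of functions of the single coordinates, so that Fubini's theorem reduces integrability
  in space to integrability on the line.
\<close>

definition decay_weight :: "real^3 \<Rightarrow> real" where
  "decay_weight x = (\<Prod>i\<in>UNIV. 1 / (1 + (x $ i)\<^sup>2))"

definition decaying :: "(real^3 \<Rightarrow> real) \<Rightarrow> bool" where
  "decaying f \<longleftrightarrow> (\<exists>C. \<forall>x. \<bar>f x\<bar> \<le> C * decay_weight x)"

lemma decay_weight_pos: "decay_weight x > 0"
  unfolding decay_weight_def by (intro prod_pos) (auto intro!: divide_pos_pos add_pos_nonneg)

lemma decay_weight_measurable [measurable]: "decay_weight \<in> borel_measurable borel"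
proof -
  have "1 + (r::real)\<^sup>2 \<noteq> 0" for r
    using add_pos_nonneg[OF zero_less_one zero_le_power2[of r]] by linarith
  then have "continuous_on UNIV decay_weight"
    unfolding decay_weight_def[abs_def] by (auto intro!: continuous_intros)
  then show ?thesis by (rule borel_measurable_continuous_onI)
qed

text \<open>
  A bounded translation changes the weight by at most a constant factor, because
  \<open>1 + b\<^sup>2 \<le> 2 (1 + a\<^sup>2) (1 + (a + b)\<^sup>2)\<close>.
\<close>

lemma decay_weight_shift:
  assumes "norm x \<le> R"
  shows "decay_weight (x + y) \<le> (2 * (1 + R\<^sup>2)) ^ 3 * decay_weight y"
proof -
  have one: "1 / (1 + (a + b)\<^sup>2) \<le> 2 * (1 + R\<^sup>2) * (1 / (1 + b\<^sup>2))" if "\<bar>a\<bar> \<le> R" for a b :: real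
  proof -
    have "a\<^sup>2 \<le> R\<^sup>2" using power_mono[OF that, of 2] by simp
    moreover have "0 \<le> (2 * a + b)\<^sup>2" by simp
    moreover have "0 \<le> R\<^sup>2 * (a + b)\<^sup>2" by simp
    ultimately have "1 + b\<^sup>2 \<le> 2 * (1 + R\<^sup>2) * (1 + (a + b)\<^sup>2)"
      by (simp add: power2_eq_square algebra_simps)
    moreover have "1 + b\<^sup>2 > 0" "1 + (a + b)\<^sup>2 > 0" by (auto intro: add_pos_nonneg)
    ultimately show ?thesis by (simp add: field_simps)
  qed
  have "decay_weight (x + y) \<le> (\<Prod>i\<in>(UNIV::3 set). 2 * (1 + R\<^sup>2) * (1 / (1 + (y $ i)\<^sup>2)))"
    unfolding decay_weight_def
  proof (intro prod_mono conjI)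
    fix i :: 3
    have "\<bar>x $ i\<bar> \<le> R" using assms component_le_norm_cart[of x i] by simp
    then show "1 / (1 + ((x + y) $ i)\<^sup>2) \<le> 2 * (1 + R\<^sup>2) * (1 / (1 + (y $ i)\<^sup>2))"
      using one by simp
  qed simp
  also have "\<dots> = (2 * (1 + R\<^sup>2)) ^ 3 * decay_weight y"
    unfolding decay_weight_def prod.distrib prod_constant by (simp del: distrib_left_numeral power_mult_distrib)
  finally show ?thesis .
qed

lemma decaying_shift_bound:
  assumes "decaying f"
  shows "\<exists>C. \<forall>x y. norm x \<le> R \<longrightarrow> \<bar>f (x + y)\<bar> \<le> C * decay_weight y"
proof -
  obtain C where C: "\<And>x. \<bar>f x\<bar> \<le> C * decay_weight x"
    using assms unfolding decaying_def by blast
  have "0 \<le> C * decay_weight 0" using C[of 0] by linarith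
  then have "C \<ge> 0" using decay_weight_pos[of 0] by (simp add: zero_le_mult_iff)
  show ?thesis
  proof (intro exI allI impI)
    fix x y :: "real^3" assume "norm x \<le> R"
    then have "C * decay_weight (x + y) \<le> C * ((2 * (1 + R\<^sup>2)) ^ 3 * decay_weight y)"
      by (intro mult_left_mono decay_weight_shift \<open>C \<ge> 0\<close>)
    then show "\<bar>f (x + y)\<bar> \<le> C * (2 * (1 + R\<^sup>2)) ^ 3 * decay_weight y"
      using C[of "x + y"] by simp
  qed
qed

lemma decaying_shift:
  assumes "decaying f"
  shows "decaying (\<lambda>y. f (x + y))"
proof -
  obtain C where "\<forall>z y. norm z \<le> norm x \<longrightarrow> \<bar>f (z + y)\<bar> \<le> C * decay_weight y"
    using decaying_shift_bound[OF assms] by blast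
  then have "\<forall>y. \<bar>f (x + y)\<bar> \<le> C * decay_weight y" by simp
  then show ?thesis unfolding decaying_def by (rule exI)
qed

lemma decaying_add:
  assumes "decaying f" "decaying g"
  shows "decaying (\<lambda>x. f x + g x)"
proof -
  obtain C where C: "\<And>x. \<bar>f x\<bar> \<le> C * decay_weight x"
    using assms(1) unfolding decaying_def by blast
  obtain D where D: "\<And>x. \<bar>g x\<bar> \<le> D * decay_weight x"
    using assms(2) unfolding decaying_def by blast
  have "\<bar>f x + g x\<bar> \<le> (C + D) * decay_weight x" for x
    using C[of x] D[of x] abs_triangle_ineq[of "f x" "g x"] by (simp add: distrib_right)
  then show ?thesis unfolding decaying_def by blast
qed

lemma decaying_mult_bounded:
  assumes "decaying f" and B: "\<And>x. \<bar>g x\<bar> \<le> B"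
  shows "decaying (\<lambda>x. f x * g x)"
proof -
  obtain C where C: "\<And>x. \<bar>f x\<bar> \<le> C * decay_weight x"
    using assms(1) unfolding decaying_def by blast
  have "\<bar>f x * g x\<bar> \<le> C * B * decay_weight x" for x
    using mult_mono[OF C[of x] B[of x]] order_trans[OF abs_ge_zero C[of x]]
    by (simp add: abs_mult algebra_simps)
  then show ?thesis unfolding decaying_def by blast
qed

lemma integrable_prod_components:
  fixes h :: "real \<Rightarrow> real"
  assumes h: "integrable lborel h" "\<And>s. h s \<ge> 0"
  shows "integrable lborel (\<lambda>y::real^'n. \<Prod>i\<in>UNIV. h (y $ i))"
proof -
  have [measurable]: "h \<in> borel_measurable borel" using h(1) by simp
  have Basis_eq: "(Basis :: (real^'n) set) = (\<lambda>i. axis i 1) ` UNIV"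
    by (auto simp: Basis_vec_def)
  have inj: "inj (\<lambda>i::'n. axis i (1::real))" by (auto simp: inj_on_def axis_eq_axis)
  have "(\<integral>\<^sup>+y. ennreal (\<Prod>i\<in>UNIV. h ((y::real^'n) $ i)) \<partial>lborel)
      = (\<integral>\<^sup>+y. (\<Prod>b\<in>Basis. ennreal (h (y \<bullet> b))) \<partial>(lborel :: (real^'n) measure))"
    using h(2) by (simp add: Basis_eq prod.reindex[OF inj] prod_ennreal inner_axis)
  also have "\<dots> = (\<Prod>b\<in>(Basis :: (real^'n) set). \<integral>\<^sup>+s. ennreal (h s) \<partial>lborel)"
    by (rule nn_integral_lborel_prod) auto
  also have "\<dots> < \<infinity>"
    using h by (simp add: nn_integral_eq_integral ennreal_power less_top)
  finally show ?thesis
    using h(2) by (intro integrableI_nonneg) (auto simp: prod_nonneg)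
qed

text \<open>
  One integrable majorant on the line for all the kernels below.  In three dimensions
  \<open>1/|y|\<close> is at most the product of the \<open>|y\<^sub>i|\<^sup>-\<^sup>1\<^sup>/\<^sup>3\<close>, which gives the exponent at the origin, and
  \<open>(1 + |y|\<^sup>2)\<^sup>-\<^sup>5\<^sup>/\<^sup>2\<close> is at most the product of the \<open>(1 + y\<^sub>i\<^sup>2)\<^sup>-\<^sup>5\<^sup>/\<^sup>6\<close>, which gives the exponent at
  infinity.
\<close>

definition singular_tail :: "real \<Rightarrow> real" where
  "singular_tail s = (if \<bar>s\<bar> \<le> 1 then \<bar>s\<bar> powr (-1/3) else \<bar>s\<bar> powr (-5/3))"

lemma singular_tail_nonneg: "singular_tail s \<ge> 0"
  by (simp add: singular_tail_def)

lemma integrable_singular_tail: "integrable lborel singular_tail"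
proof -
  have powr_int: "integrable lborel (\<lambda>s. indicator A s *\<^sub>R s powr a)"
    if "(\<lambda>s. s powr a) integrable_on A" "A \<in> sets borel" for A and a :: real
  proof -
    have "(\<lambda>s. s powr a) absolutely_integrable_on A"
      using that(1) by (subst absolutely_integrable_on_iff_nonneg) auto
    then have "integrable lebesgue (\<lambda>s. indicator A s *\<^sub>R s powr a)"
      by (simp add: set_integrable_def)
    then show ?thesis
      using that(2) by (subst (asm) integrable_completion) auto
  qed
  let ?k = "\<lambda>s::real. indicator {0..1} s *\<^sub>R s powr (-1/3) + indicator {1..} s *\<^sub>R s powr (-5/3)"
  have k: "integrable lborel ?k"
  proof (intro Bochner_Integration.integrable_add powr_int)
    show "(\<lambda>s::real. s powr (-1/3)) integrable_on {0..1}"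
      by (rule integrable_on_powr_from_0) auto
    show "(\<lambda>s::real. s powr (-5/3)) integrable_on {1..}"
      using has_integral_powr_to_inf[of "-5/3" 1] by auto
  qed auto
  \<comment> \<open>The function is even, and \<open>?k\<close> dominates it on the positive half-line.\<close>
  have "integrable lborel (\<lambda>s. ?k s + ?k (0 + (-1) * s))"
    by (intro Bochner_Integration.integrable_add k lborel_integrable_real_affine[OF k]) simp
  then show ?thesis
  proof (rule Bochner_Integration.integrable_bound)
    show "AE s in lborel. norm (singular_tail s) \<le> norm (?k s + ?k (0 + (-1) * s))"
      by (intro AE_I2) (auto simp: singular_tail_def indicator_def abs_if)
  qed (simp add: singular_tail_def[abs_def])
qed

lemma AE_components_nonzero: "AE y in (lborel :: (real^3) measure). \<forall>i. y $ i \<noteq> 0"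
proof -
  have "AE y in (lborel :: (real^3) measure). y $ i \<noteq> 0" for i
  proof -
    have "negligible {y :: real^3. y \<bullet> axis i 1 = 0}"
      by (rule negligible_standard_hyperplane) (auto simp: Basis_vec_def)
    then have "{y :: real^3. y \<bullet> axis i 1 = 0} \<in> null_sets lebesgue"
      by (simp add: negligible_iff_null_sets)
    then have "AE y in (lebesgue :: (real^3) measure). y \<notin> {y. y \<bullet> axis i 1 = 0}"
      by (rule AE_not_in)
    then show ?thesis
      by (simp add: AE_completion_iff inner_axis)
  qed
  then show ?thesis by (simp add: AE_all_countable)
qed

text \<open>
  Points with a vanishing coordinate form a null set.  They must be excluded: there \<open>0 powr a = 0\<close>
  makes the majorant vanish.
\<close>

lemma integrable_of_component_bounds:
  fixes f :: "real^3 \<Rightarrow> real"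
  assumes "f \<in> borel_measurable borel"
    and le: "\<And>y. (\<And>i. y $ i \<noteq> 0) \<Longrightarrow> \<bar>f y\<bar> \<le> (\<Prod>i\<in>UNIV. singular_tail (y $ i))"
  shows "integrable lborel f"
proof (rule Bochner_Integration.integrable_bound)
  show "integrable lborel (\<lambda>y::real^3. \<Prod>i\<in>UNIV. singular_tail (y $ i))"
    by (rule integrable_prod_components[OF integrable_singular_tail singular_tail_nonneg])
  show "AE y in lborel. norm (f y) \<le> norm (\<Prod>i\<in>UNIV. singular_tail (y $ i))"
    using AE_components_nonzero
    by eventually_elim (use le in \<open>simp add: prod_nonneg singular_tail_nonneg\<close>)
qed (use assms(1) in simp)

lemma inverse_square_le_singular_tail:
  assumes "s \<noteq> 0"
  shows "1 / (1 + s\<^sup>2) * \<bar>s\<bar> powr (-1/3) \<le> singular_tail s"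
    and "1 / (1 + s\<^sup>2) \<le> singular_tail s"
    and "(1 + s\<^sup>2) powr (-5/6) \<le> singular_tail s"
proof -
  have pos: "1 + s\<^sup>2 > 0" by (simp add: add_pos_nonneg)
  have s2: "s\<^sup>2 = \<bar>s\<bar> powr 2" using assms by (simp add: powr_numeral)
  show a: "1 / (1 + s\<^sup>2) * \<bar>s\<bar> powr (-1/3) \<le> singular_tail s"
  proof (cases "\<bar>s\<bar> \<le> 1")
    case True
    have "1 / (1 + s\<^sup>2) * \<bar>s\<bar> powr (-1/3) \<le> 1 * \<bar>s\<bar> powr (-1/3)"
      using pos by (intro mult_right_mono) auto
    then show ?thesis using True by (simp add: singular_tail_def)
  next
    case False
    have "1 / (1 + s\<^sup>2) \<le> 1 / s\<^sup>2" using assms pos by (intro divide_left_mono) auto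
    also have "1 / s\<^sup>2 = \<bar>s\<bar> powr (-2)" by (simp add: powr_minus_divide)
    finally have "1 / (1 + s\<^sup>2) * \<bar>s\<bar> powr (-1/3) \<le> \<bar>s\<bar> powr (-2) * \<bar>s\<bar> powr (-1/3)"
      by (intro mult_right_mono) auto
    also have "\<dots> = \<bar>s\<bar> powr (-7/3)" by (subst powr_add[symmetric]) simp
    also have "\<dots> \<le> \<bar>s\<bar> powr (-5/3)" using False by (intro powr_mono) auto
    finally show ?thesis using False by (simp add: singular_tail_def)
  qed
  have c: "(1 + s\<^sup>2) powr (-5/6) \<le> singular_tail s"
  proof (cases "\<bar>s\<bar> \<le> 1")
    case True
    have "(1 + s\<^sup>2) powr (-5/6) \<le> 1 powr (-5/6)" by (intro powr_mono2') auto
    also have "\<dots> \<le> \<bar>s\<bar> powr (-1/3)"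
      using True assms powr_mono2'[of "-1/3" "\<bar>s\<bar>" 1] by simp
    finally show ?thesis using True by (simp add: singular_tail_def)
  next
    case False
    have "(1 + s\<^sup>2) powr (-5/6) \<le> (s\<^sup>2) powr (-5/6)" using assms by (intro powr_mono2') auto
    also have "\<dots> = \<bar>s\<bar> powr (-5/3)" unfolding s2 powr_powr by simp
    finally show ?thesis using False by (simp add: singular_tail_def)
  qed
  then show "(1 + s\<^sup>2) powr (-5/6) \<le> singular_tail s" .
  have "1 / (1 + s\<^sup>2) = (1 + s\<^sup>2) powr (-1)" using pos by (simp add: powr_minus_divide)
  also have "\<dots> \<le> (1 + s\<^sup>2) powr (-5/6)" by (intro powr_mono) auto
  finally show "1 / (1 + s\<^sup>2) \<le> singular_tail s" using c by simp
qed

lemma integrable_decay_weight: "integrable lborel decay_weight"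
proof (rule integrable_of_component_bounds)
  fix y :: "real^3" assume "\<And>i. y $ i \<noteq> 0"
  then show "\<bar>decay_weight y\<bar> \<le> (\<Prod>i\<in>UNIV. singular_tail (y $ i))"
    unfolding abs_of_pos[OF decay_weight_pos] unfolding decay_weight_def
    by (intro prod_mono conjI inverse_square_le_singular_tail(2)) auto
qed simp

lemma integrable_decay_weight_newton: "integrable lborel (\<lambda>y. decay_weight y * inverse (norm y))"
proof (rule integrable_of_component_bounds)
  fix y :: "real^3" assume nz: "\<And>i. y $ i \<noteq> 0"
  have "y \<noteq> 0" using nz[of 1] by auto
  have "(\<Prod>i\<in>(UNIV::3 set). norm y powr (-1/3)) = (norm y powr (-1/3)) ^ 3" by simp
  also have "\<dots> = norm y powr (-1)"
    using \<open>y \<noteq> 0\<close> by (subst powr_power) auto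
  finally have "inverse (norm y) = (\<Prod>i\<in>(UNIV::3 set). norm y powr (-1/3))"
    using \<open>y \<noteq> 0\<close> by (simp add: powr_minus)
  also have "\<dots> \<le> (\<Prod>i\<in>UNIV. \<bar>y $ i\<bar> powr (-1/3))"
  proof (intro prod_mono conjI powr_mono2')
    fix i
    show "0 < \<bar>y $ i\<bar>" using nz[of i] by simp
    show "\<bar>y $ i\<bar> \<le> norm y" by (rule component_le_norm_cart)
  qed auto
  finally have "decay_weight y * inverse (norm y)
      \<le> decay_weight y * (\<Prod>i\<in>UNIV. \<bar>y $ i\<bar> powr (-1/3))"
    by (intro mult_left_mono less_imp_le[OF decay_weight_pos])
  also have "\<dots> \<le> (\<Prod>i\<in>UNIV. singular_tail (y $ i))"
    unfolding decay_weight_def prod.distrib[symmetric]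
    by (intro prod_mono conjI inverse_square_le_singular_tail(1) nz mult_nonneg_nonneg) auto
  finally show "\<bar>decay_weight y * inverse (norm y)\<bar> \<le> (\<Prod>i\<in>UNIV. singular_tail (y $ i))"
    using decay_weight_pos[of y] by (simp add: abs_mult)
qed simp

text \<open>
  The kernel \<open>1/|y|\<close> with its singularity at the origin smoothed out at scale \<open>\<epsilon>\<close>.
\<close>

definition reg_kernel :: "real \<Rightarrow> real^3 \<Rightarrow> real" where
  "reg_kernel \<epsilon> y = inverse (sqrt ((norm y)\<^sup>2 + \<epsilon>\<^sup>2))"

lemma integrable_reg_kernel_pow5: "integrable lborel (\<lambda>y. reg_kernel 1 y ^ 5)"
proof (rule integrable_of_component_bounds)
  fix y :: "real^3" assume nz: "\<And>i. y $ i \<noteq> 0"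
  have pos: "1 + (norm y)\<^sup>2 > 0" by (simp add: add_pos_nonneg)
  have "reg_kernel 1 y ^ 5 = (\<Prod>i\<in>(UNIV::3 set). (1 + (norm y)\<^sup>2) powr (-5/6))"
  proof -
    have "reg_kernel 1 y = (1 + (norm y)\<^sup>2) powr (-1/2)"
      using pos by (simp add: reg_kernel_def powr_minus powr_half_sqrt add.commute)
    then show ?thesis using pos by (simp add: powr_power)
  qed
  also have "\<dots> \<le> (\<Prod>i\<in>UNIV. (1 + (y $ i)\<^sup>2) powr (-5/6))"
  proof (intro prod_mono conjI powr_mono2')
    fix i
    show "1 + (y $ i)\<^sup>2 \<le> 1 + (norm y)\<^sup>2"
      using power_mono[OF component_le_norm_cart[of y i], of 2] by simp
    show "0 < 1 + (y $ i)\<^sup>2" by (simp add: add_pos_nonneg)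
  qed auto
  also have "\<dots> \<le> (\<Prod>i\<in>UNIV. singular_tail (y $ i))"
    by (intro prod_mono conjI inverse_square_le_singular_tail(3) nz) auto
  finally show "\<bar>reg_kernel 1 y ^ 5\<bar> \<le> (\<Prod>i\<in>UNIV. singular_tail (y $ i))"
    by (simp add: reg_kernel_def)
qed (simp add: reg_kernel_def[abs_def])

section \<open>Schwartz functions\<close>

lemma partial_deriv_eq_dir_deriv: "partial_deriv i f = dir_deriv (axis i 1) f"
  by (simp add: fun_eq_iff partial_deriv_def dir_deriv_def)

lemma smooth_partial_deriv: "smooth f \<Longrightarrow> smooth (partial_deriv i f)"
  unfolding partial_deriv_eq_dir_deriv by (rule smooth_dir_deriv)

lemma smooth_partial_deriv_funpow: "smooth f \<Longrightarrow> smooth ((partial_deriv i ^^ n) f)"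
  by (induction n) (simp_all add: smooth_partial_deriv)

lemma partial_deriv_commute: "smooth f \<Longrightarrow> partial_deriv i (partial_deriv j f) = partial_deriv j (partial_deriv i f)"
  unfolding partial_deriv_eq_dir_deriv by (rule dir_deriv_commute)

lemma partial_deriv_funpow_commute:
  "smooth f \<Longrightarrow> (partial_deriv j ^^ n) (partial_deriv i f) = partial_deriv i ((partial_deriv j ^^ n) f)"
  by (induction n) (simp_all add: partial_deriv_commute smooth_partial_deriv_funpow)

text \<open>
  Because partial derivatives commute, one more derivative just raises an entry of the multi-index,
  so the Schwartz class is closed under partial derivatives.
\<close>

lemma multi_deriv_partial_deriv:
  assumes "smooth f"
  shows "multi_deriv \<beta> (partial_deriv i f) = multi_deriv (\<beta> + axis i 1) f"
  using exhaust_3[of i]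
  by (elim disjE)
    (simp_all add: multi_deriv_def axis_def assms
      partial_deriv_funpow_commute smooth_partial_deriv_funpow)

lemma schwartz_smooth: "f \<in> schwartz \<Longrightarrow> smooth f"
  by (simp add: schwartz_def)

lemma schwartz_partial_deriv: "f \<in> schwartz \<Longrightarrow> partial_deriv i f \<in> schwartz"
  by (simp add: schwartz_def smooth_partial_deriv multi_deriv_partial_deriv)

text \<open>
  Expanding \<open>\<Prod>i. 1 + x\<^sub>i\<^sup>2\<close> gives a sum of monomials with exponents 0 and 2; the Schwartz
  condition bounds each of them times \<open>f\<close>.
\<close>

lemma schwartz_decaying:
  assumes "f \<in> schwartz"
  shows "decaying f"
proof -
  have mono_bound: "\<exists>C. \<forall>x. \<bar>(\<Prod>i\<in>UNIV. x $ i ^ (\<alpha> $ i)) * f x\<bar> \<le> C" for \<alpha> :: "nat^3"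
  proof -
    have "multi_deriv 0 f = f" by (simp add: multi_deriv_def)
    moreover have "bounded (range (\<lambda>x. (\<Prod>i\<in>UNIV. x $ i ^ (\<alpha> $ i)) * multi_deriv 0 f x))"
      using assms by (simp add: schwartz_def)
    ultimately show ?thesis unfolding bounded_iff by auto
  qed
  have "\<exists>C. \<forall>X x. \<bar>(\<Prod>i\<in>UNIV. x $ i ^ (if i \<in> X then 0 else 2)) * f x\<bar> \<le> C X"
  proof -
    have "\<forall>X. \<exists>C. \<forall>x. \<bar>(\<Prod>i\<in>UNIV. x $ i ^ (if i \<in> X then 0 else 2)) * f x\<bar> \<le> C"
      using mono_bound[of "\<chi> i. if i \<in> _ then 0 else 2"] by simp
    then show ?thesis by (rule choice)
  qed
  then obtain C where C: "\<And>X x. \<bar>(\<Prod>i\<in>UNIV. x $ i ^ (if i \<in> X then 0 else 2)) * f x\<bar> \<le> C X"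
    by blast
  have expand: "(\<Prod>i\<in>UNIV. 1 + (x $ i)\<^sup>2) = (\<Sum>X\<in>Pow UNIV. \<Prod>i\<in>UNIV. x $ i ^ (if i \<in> X then 0 else 2))"
    for x :: "real^3"
    unfolding prod_add[OF finite]
    by (intro sum.cong refl) (simp add: prod.If_cases if_distrib Compl_eq_Diff_UNIV cong: if_cong)
  have "\<bar>f x\<bar> \<le> (\<Sum>X\<in>Pow UNIV. C X) * decay_weight x" for x
  proof -
    have pos: "(\<Prod>i\<in>UNIV. 1 + (x $ i)\<^sup>2) > 0" by (intro prod_pos) (simp add: add_pos_nonneg)
    have "\<bar>(\<Prod>i\<in>UNIV. 1 + (x $ i)\<^sup>2) * f x\<bar> \<le> (\<Sum>X\<in>Pow UNIV. C X)"
      unfolding expand sum_distrib_right by (intro order_trans[OF sum_abs] sum_mono C)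
    then have "(\<Prod>i\<in>UNIV. 1 + (x $ i)\<^sup>2) * \<bar>f x\<bar> \<le> (\<Sum>X\<in>Pow UNIV. C X)"
      using pos by (simp add: abs_mult)
    then show ?thesis
      using pos by (simp add: decay_weight_def prod_dividef field_simps)
  qed
  then show ?thesis unfolding decaying_def by blast
qed

section \<open>The Newtonian potential\<close>

lemma has_derivative_shift:
  fixes f :: "'a::euclidean_space \<Rightarrow> real"
  assumes "\<And>z. f differentiable (at z)"
  shows "((\<lambda>x. f (x + y) * c) has_derivative (\<lambda>v. dir_deriv v f (x + y) * c)) (at x)"
proof -
  have "((\<lambda>x. x + y) has_derivative (\<lambda>v. v)) (at x)"
    by (auto intro!: derivative_eq_intros)
  from has_derivative_compose[OF this has_derivative_dir_deriv[OF assms]]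
  show ?thesis by (rule has_derivative_mult_left)
qed

lemma dominated_family_shift:
  fixes k :: "real^3 \<Rightarrow> real"
  assumes f: "f \<in> borel_measurable borel" "decaying f"
    and k: "k \<in> borel_measurable borel" "integrable lborel (\<lambda>y. decay_weight y * \<bar>k y\<bar>)"
  shows "dominated_family lborel (\<lambda>y x. f (x + y) * k y)"
  unfolding dominated_family_def
proof (intro conjI allI)
  fix x :: "real^3"
  have [measurable]: "f \<in> borel_measurable borel" "k \<in> borel_measurable borel" by fact+
  show "(\<lambda>y. f (x + y) * k y) \<in> borel_measurable lborel" by measurable
  obtain C where C: "\<forall>z y. norm z \<le> norm x + 1 \<longrightarrow> \<bar>f (z + y)\<bar> \<le> C * decay_weight y"
    using decaying_shift_bound[OF f(2)] by blast
  show "\<exists>h. integrable lborel h \<and> (\<forall>y. \<forall>z\<in>ball x 1. \<bar>f (z + y) * k y\<bar> \<le> h y)"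
  proof (intro exI conjI allI ballI)
    show "integrable lborel (\<lambda>y. C * (decay_weight y * \<bar>k y\<bar>))" using k(2) by simp
    fix y z assume "z \<in> ball x 1"
    then have "norm z \<le> norm x + 1"
      using norm_triangle_ineq2[of z x] by (simp add: dist_norm norm_minus_commute)
    then have "\<bar>f (z + y)\<bar> * \<bar>k y\<bar> \<le> C * decay_weight y * \<bar>k y\<bar>"
      using C by (intro mult_right_mono) auto
    then show "\<bar>f (z + y) * k y\<bar> \<le> C * (decay_weight y * \<bar>k y\<bar>)"
      by (simp add: abs_mult mult.assoc)
  qed
qed

definition newton_potential :: "(real^3 \<Rightarrow> real) \<Rightarrow> real^3 \<Rightarrow> real" where
  "newton_potential f x = (\<integral>y. f (x + y) * inverse (norm y) \<partial>lborel)"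

lemma dominated_newton:
  assumes "f \<in> schwartz"
  shows "dominated_family lborel (\<lambda>y x. f (x + y) * inverse (norm y))"
  by (rule dominated_family_shift)
    (simp_all add: assms smooth_borel_measurable schwartz_smooth schwartz_decaying
      integrable_decay_weight_newton)

lemma dir_deriv_newton_integrand:
  fixes f :: "real^3 \<Rightarrow> real"
  assumes "smooth f"
  shows "dir_deriv v (\<lambda>x. f (x + y) * c) = (\<lambda>x. dir_deriv v f (x + y) * c)"
  by (intro ext dir_deriv_eqI has_derivative_shift smooth_differentiable assms)

lemma differentiable_newton_integrand:
  fixes f :: "real^3 \<Rightarrow> real"
  assumes "smooth f"
  shows "(\<lambda>x. f (x + y) * c) differentiable (at x)"
  unfolding differentiable_def
  by (rule exI, rule has_derivative_shift, rule smooth_differentiable, rule assms)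

lemma Basis_vec_3_axis: "b \<in> (Basis :: (real^3) set) \<Longrightarrow> \<exists>i. b = axis i 1"
  by (auto simp: Basis_vec_def)

lemma partial_deriv_newton_potential:
  assumes f: "f \<in> schwartz"
  shows "partial_deriv i (newton_potential f) = newton_potential (partial_deriv i f)"
proof -
  have dom': "dominated_family lborel (\<lambda>y. dir_deriv b (\<lambda>x. f (x + y) * inverse (norm y)))"
    if b: "b \<in> Basis" for b
  proof -
    obtain j where "b = axis j 1" using Basis_vec_3_axis[OF b] by blast
    then show ?thesis
      using dominated_newton[OF schwartz_partial_deriv[OF f, of j]]
      by (simp add: dir_deriv_newton_integrand schwartz_smooth[OF f] partial_deriv_eq_dir_deriv)
  qed
  show ?thesis
    unfolding partial_deriv_eq_dir_deriv newton_potential_def[abs_def]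
    by (subst dir_deriv_integral[OF _ dominated_newton[OF f] dom'])
      (rule differentiable_newton_integrand[OF schwartz_smooth[OF f]], assumption,
        simp only: dir_deriv_newton_integrand[OF schwartz_smooth[OF f]])
qed

lemma smooth_newton_potential:
  assumes f: "f \<in> schwartz"
  shows "smooth (newton_potential f)"
  unfolding newton_potential_def[abs_def]
proof (rule smooth_integral)
  let ?S = "(\<lambda>f y x. f (x + y) * inverse (norm y)) ` schwartz"
  show "(\<lambda>y x. f (x + y) * inverse (norm y)) \<in> ?S" using f by (rule imageI)
  fix G :: "real^3 \<Rightarrow> real^3 \<Rightarrow> real" assume "G \<in> ?S"
  then obtain g where g: "g \<in> schwartz" and G: "G = (\<lambda>y x. g (x + y) * inverse (norm y))" by blast
  show "G y differentiable (at x)" for y x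
    unfolding G by (rule differentiable_newton_integrand[OF schwartz_smooth[OF g]])
  show "dominated_family lborel G"
    unfolding G by (rule dominated_newton[OF g])
  show "(\<lambda>y. dir_deriv b (G y)) \<in> ?S" if b: "b \<in> Basis" for b
  proof -
    obtain j where "b = axis j 1" using Basis_vec_3_axis[OF b] by blast
    then have "(\<lambda>y. dir_deriv b (G y)) = (\<lambda>y x. partial_deriv j g (x + y) * inverse (norm y))"
      by (simp add: G dir_deriv_newton_integrand schwartz_smooth[OF g] partial_deriv_eq_dir_deriv)
    then show ?thesis using schwartz_partial_deriv[OF g, of j] by (intro image_eqI[of _ _ "partial_deriv j g"])
  qed
qed

lemma decaying_integrable:
  assumes "decaying f" "f \<in> borel_measurable borel"
  shows "integrable lborel f"
proof -
  obtain C where C: "\<And>x. \<bar>f x\<bar> \<le> C * decay_weight x"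
    using assms(1) unfolding decaying_def by blast
  have "integrable lborel (\<lambda>x. C * decay_weight x)" using integrable_decay_weight by simp
  then show ?thesis
  proof (rule Bochner_Integration.integrable_bound)
    show "AE x in lborel. norm (f x) \<le> norm (C * decay_weight x)"
      using C by (intro AE_I2) (simp add: order_trans[OF _ abs_ge_self])
  qed (use assms(2) in simp)
qed

lemma dominated_family_line:
  assumes f: "f \<in> borel_measurable borel" "decaying f"
  shows "dominated_family lborel (\<lambda>y s. f (y + s *\<^sub>R e))"
  unfolding dominated_family_def
proof (intro conjI allI)
  fix s :: real
  have [measurable]: "f \<in> borel_measurable borel" by fact
  show "(\<lambda>y. f (y + s *\<^sub>R e)) \<in> borel_measurable lborel" by measurable
  obtain C where C: "\<forall>z y. norm z \<le> (\<bar>s\<bar> + 1) * norm e \<longrightarrow> \<bar>f (z + y)\<bar> \<le> C * decay_weight y"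
    using decaying_shift_bound[OF f(2)] by blast
  show "\<exists>h. integrable lborel h \<and> (\<forall>y. \<forall>r\<in>ball s 1. \<bar>f (y + r *\<^sub>R e)\<bar> \<le> h y)"
  proof (intro exI conjI allI ballI)
    show "integrable lborel (\<lambda>y. C * decay_weight y)" using integrable_decay_weight by simp
    fix y r assume "r \<in> ball s 1"
    then have "\<bar>r\<bar> \<le> \<bar>s\<bar> + 1" by (simp add: dist_real_def)
    then have "norm (r *\<^sub>R e) \<le> (\<bar>s\<bar> + 1) * norm e" by (simp add: mult_right_mono)
    from C[rule_format, OF this, of y]
    show "\<bar>f (y + r *\<^sub>R e)\<bar> \<le> C * decay_weight y" by (simp add: add.commute)
  qed
qed

text \<open>
  Integration by parts in a form free of boundary terms: the integral of \<open>y \<mapsto> g (y + s e)\<close> does not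
  depend on \<open>s\<close> by translation invariance of Lebesgue measure, and its derivative at \<open>s = 0\<close> is the
  integral of the directional derivative.
\<close>

lemma integral_dir_deriv_eq_0:
  fixes g :: "real^3 \<Rightarrow> real"
  assumes diff: "\<And>x. g differentiable (at x)"
    and g: "decaying g"
    and g': "decaying (dir_deriv e g)" "dir_deriv e g \<in> borel_measurable borel"
  shows "(\<integral>y. dir_deriv e g y \<partial>lborel) = 0"
proof -
  have gm [measurable]: "g \<in> borel_measurable borel"
    by (intro borel_measurable_continuous_onI continuous_at_imp_continuous_on ballI
        differentiable_imp_continuous_within diff)
  let ?G = "\<lambda>y s. g (y + s *\<^sub>R e)"
  have der: "(?G y has_derivative (\<lambda>r. dir_deriv e g (y + s *\<^sub>R e) * r)) (at s)" for y s
    using dir_deriv_along_line[OF diff, where a=y and s=s and v=e] by (simp add: has_field_derivative_def)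
  have dir: "dir_deriv r (?G y) = (\<lambda>s. dir_deriv e g (y + s *\<^sub>R e) * r)" for r y
    by (intro ext dir_deriv_eqI[OF der])
  have "((\<lambda>s. \<integral>y. ?G y s \<partial>lborel) has_derivative (\<lambda>r. \<integral>y. dir_deriv r (?G y) 0 \<partial>lborel)) (at 0)"
  proof (rule has_derivative_integral_dominated)
    show "?G y differentiable (at s)" for y s using der unfolding differentiable_def by blast
    show "dominated_family lborel ?G" by (rule dominated_family_line[OF gm g])
    show "dominated_family lborel (\<lambda>y. dir_deriv b (?G y))" if "b \<in> Basis" for b :: real
      using that dominated_family_line[OF g'(2,1)] by (simp add: dir)
  qed
  moreover have "(\<integral>y. ?G y s \<partial>lborel) = (\<integral>y. g y \<partial>lborel)" for s
  proof -
    have "(\<integral>y. g y \<partial>lborel) = (\<integral>y. g y \<partial>(distr lborel borel ((+) (s *\<^sub>R e))))"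
      by (simp add: lborel_distr_plus)
    also have "\<dots> = (\<integral>y. ?G y s \<partial>lborel)"
      by (subst integral_distr) (simp_all add: add.commute)
    finally show ?thesis by simp
  qed
  ultimately have "((\<lambda>s::real. \<integral>y. g y \<partial>lborel) has_derivative (\<lambda>r. \<integral>y. dir_deriv r (?G y) 0 \<partial>lborel)) (at 0)"
    by simp
  from has_derivative_unique[OF this has_derivative_const]
  have "(\<integral>y. dir_deriv 1 (?G y) 0 \<partial>lborel) = 0" by (rule fun_cong)
  then show ?thesis by (simp add: dir)
qed

lemma reg_kernel_measurable [measurable]: "reg_kernel \<epsilon> \<in> borel_measurable borel"
  by (simp add: reg_kernel_def[abs_def])

lemma reg_kernel_inverse_square:
  assumes "\<epsilon> > 0"
  shows "reg_kernel \<epsilon> y > 0" and "((norm y)\<^sup>2 + \<epsilon>\<^sup>2) * reg_kernel \<epsilon> y ^ 2 = 1"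
proof -
  have pos: "(norm y)\<^sup>2 + \<epsilon>\<^sup>2 > 0" using assms by (simp add: add_nonneg_pos)
  then show "reg_kernel \<epsilon> y > 0" by (simp add: reg_kernel_def)
  have "reg_kernel \<epsilon> y ^ 2 = inverse ((norm y)\<^sup>2 + \<epsilon>\<^sup>2)"
    using pos by (simp add: reg_kernel_def power_inverse)
  then show "((norm y)\<^sup>2 + \<epsilon>\<^sup>2) * reg_kernel \<epsilon> y ^ 2 = 1"
    using right_inverse[OF less_imp_neq[OF pos, symmetric]] by simp
qed

lemma reg_kernel_bounds:
  assumes "\<epsilon> > 0"
  shows "reg_kernel \<epsilon> y \<le> 1 / \<epsilon>" and "\<bar>y $ i * reg_kernel \<epsilon> y\<bar> \<le> 1"
proof -
  note K = reg_kernel_inverse_square[OF assms, of y]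
  have sum: "\<epsilon>\<^sup>2 * (reg_kernel \<epsilon> y)\<^sup>2 + (norm y)\<^sup>2 * (reg_kernel \<epsilon> y)\<^sup>2 = 1"
    using K(2) by (simp add: algebra_simps)
  have nonneg: "0 \<le> \<epsilon>\<^sup>2 * (reg_kernel \<epsilon> y)\<^sup>2" "0 \<le> (norm y)\<^sup>2 * (reg_kernel \<epsilon> y)\<^sup>2"
    by simp_all
  have "(\<epsilon> * reg_kernel \<epsilon> y)\<^sup>2 \<le> 1\<^sup>2"
    unfolding power_mult_distrib power_one using sum nonneg(2) by linarith
  then have "\<epsilon> * reg_kernel \<epsilon> y \<le> 1" by (rule power2_le_imp_le) simp
  then show "reg_kernel \<epsilon> y \<le> 1 / \<epsilon>" using assms by (simp add: field_simps)
  have "(norm y * reg_kernel \<epsilon> y)\<^sup>2 \<le> 1\<^sup>2"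
    unfolding power_mult_distrib power_one using sum nonneg(1) by linarith
  then have le_1: "norm y * reg_kernel \<epsilon> y \<le> 1" by (rule power2_le_imp_le) simp
  have "\<bar>y $ i * reg_kernel \<epsilon> y\<bar> = \<bar>y $ i\<bar> * reg_kernel \<epsilon> y" using K(1) by (simp add: abs_mult)
  also have "\<dots> \<le> norm y * reg_kernel \<epsilon> y"
    using K(1) component_le_norm_cart by (intro mult_right_mono) auto
  finally show "\<bar>y $ i * reg_kernel \<epsilon> y\<bar> \<le> 1" using le_1 by linarith
qed

lemma has_derivative_reg_kernel:
  assumes "\<epsilon> > 0"
  shows "(reg_kernel \<epsilon> has_derivative (\<lambda>v. - (y \<bullet> v) * reg_kernel \<epsilon> y ^ 3)) (at y)"
proof -
  have pos: "y \<bullet> y + \<epsilon>\<^sup>2 > 0" using assms by (simp add: add_nonneg_pos)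
  let ?q = "\<lambda>y. y \<bullet> y + \<epsilon>\<^sup>2"
  have q: "(?q has_derivative (\<lambda>v. y \<bullet> v + v \<bullet> y + 0)) (at y)"
    by (intro has_derivative_add has_derivative_inner has_derivative_ident has_derivative_const)
  have "sqrt (?q y) \<noteq> 0" using pos by simp
  from DERIV_compose_FDERIV[OF DERIV_inverse'[OF DERIV_real_sqrt[OF pos] this] q]
  have "((\<lambda>y. inverse (sqrt (?q y))) has_derivative (\<lambda>v. (y \<bullet> v + v \<bullet> y + 0) *
      - (inverse (sqrt (?q y)) * (inverse (sqrt (?q y)) / 2) * inverse (sqrt (?q y))))) (at y)" .
  moreover have "(\<lambda>y. inverse (sqrt (?q y))) = reg_kernel \<epsilon>"
    by (simp add: fun_eq_iff reg_kernel_def dot_square_norm)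
  moreover have "inverse (sqrt (?q y)) = reg_kernel \<epsilon> y"
    by (simp add: reg_kernel_def dot_square_norm)
  moreover have "(y \<bullet> v + v \<bullet> y + 0) * - (K * (K / 2) * K) = - (y \<bullet> v) * K ^ 3" for v and K :: real
    by (simp add: inner_commute power3_eq_cube)
  ultimately show ?thesis by simp
qed

section \<open>Poisson's equation\<close>

text \<open>
  Green's identity for \<open>f\<close> and the smoothed kernel \<open>K\<close>.  For each \<open>i\<close> the function
  \<open>\<partial>\<^sub>i f K - f \<partial>\<^sub>i K\<close> decays, so its derivative along the \<open>i\<close>-th axis has integral zero; this moves both
  derivatives from \<open>f\<close> to \<open>K\<close>.  Since \<open>\<partial>\<^sub>i K = - y\<^sub>i K\<^sup>3\<close>, summing over \<open>i\<close> gives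
  \<open>\<nabla>\<^sup>2 K = - 3 K\<^sup>3 + 3 |y|\<^sup>2 K\<^sup>5 = - 3 \<epsilon>\<^sup>2 K\<^sup>5\<close>.
\<close>

lemma integral_laplacian_reg_kernel:
  assumes f: "f \<in> schwartz" and \<epsilon>: "\<epsilon> > 0"
  shows "(\<integral>y. laplacian f (x + y) * reg_kernel \<epsilon> y \<partial>lborel)
    = - (\<integral>y. f (x + y) * (3 * \<epsilon>\<^sup>2 * reg_kernel \<epsilon> y ^ 5) \<partial>lborel)"
proof -
  let ?K = "reg_kernel \<epsilon>"
  let ?g = "\<lambda>y. f (x + y)"
  let ?g1 = "\<lambda>i y. partial_deriv i f (x + y)"
  let ?g2 = "\<lambda>i y. partial_deriv i (partial_deriv i f) (x + y)"
  let ?k2 = "\<lambda>i y. ?K y ^ 3 - 3 * (y $ i)\<^sup>2 * ?K y ^ 5"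
  note K_pos = reg_kernel_inverse_square(1)[OF \<epsilon>]
  have K_le: "\<bar>?K y ^ n\<bar> \<le> (1 / \<epsilon>) ^ n" for y n
    using K_pos[of y] reg_kernel_bounds(1)[OF \<epsilon>, of y] by (simp add: power_mono del: power_divide)
  have yK_le: "\<bar>y $ i * ?K y\<bar> \<le> 1" for y i by (rule reg_kernel_bounds(2)[OF \<epsilon>])
  have k1_le: "\<bar>y $ i * ?K y ^ 3\<bar> \<le> (1 / \<epsilon>) ^ 2" for y i
  proof -
    have "\<bar>y $ i * ?K y ^ 3\<bar> = \<bar>y $ i * ?K y\<bar> * \<bar>?K y ^ 2\<bar>"
      by (simp add: abs_mult power2_eq_square power3_eq_cube)
    also have "\<dots> \<le> 1 * (1 / \<epsilon>) ^ 2" by (intro mult_mono yK_le K_le) auto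
    finally show ?thesis by simp
  qed
  have k2_le: "\<bar>?k2 i y\<bar> \<le> (1 / \<epsilon>) ^ 3 + 3 * (1 / \<epsilon>) ^ 3" for y i
  proof -
    have "3 * (y $ i)\<^sup>2 * ?K y ^ 5 = 3 * ((y $ i * ?K y)\<^sup>2 * ?K y ^ 3)"
      by (simp add: eval_nat_numeral)
    then have "\<bar>3 * (y $ i)\<^sup>2 * ?K y ^ 5\<bar> = 3 * (\<bar>y $ i * ?K y\<bar>\<^sup>2 * \<bar>?K y ^ 3\<bar>)"
      by (simp only: abs_mult power_abs abs_numeral)
    also have "\<dots> \<le> 3 * (1\<^sup>2 * (1 / \<epsilon>) ^ 3)"
      by (intro mult_left_mono mult_mono power_mono yK_le K_le) auto
    also have "\<dots> = 3 * (1 / \<epsilon>) ^ 3" by simp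
    finally show ?thesis
      using K_le[of y 3] abs_triangle_ineq4[of "?K y ^ 3" "3 * (y $ i)\<^sup>2 * ?K y ^ 5"] by linarith
  qed
  have shift: "smooth (\<lambda>y. h (x + y))" if "smooth h" for h :: "real^3 \<Rightarrow> real"
    using smooth_comp_affine[OF bounded_linear_ident that, of x] by (simp add: add.commute[of x])
  have smooth_i: "smooth (?g1 i)" "smooth (?g2 i)" for i
    by (intro shift smooth_partial_deriv schwartz_smooth f)+
  have smooth_g: "smooth ?g" by (intro shift schwartz_smooth f)
  have decay: "decaying ?g" "decaying (?g1 i)" "decaying (?g2 i)" for i
    by (intro decaying_shift schwartz_decaying schwartz_partial_deriv f)+
  have der_g: "(?g has_derivative (\<lambda>v. dir_deriv v f (x + y))) (at y)" for y
    using has_derivative_shift[of f x 1 y, OF smooth_differentiable[OF schwartz_smooth[OF f]]]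
    by (simp add: add.commute)
  have der_g1: "(?g1 i has_derivative (\<lambda>v. dir_deriv v (partial_deriv i f) (x + y))) (at y)" for i y
    using has_derivative_shift[of "partial_deriv i f" x 1 y,
        OF smooth_differentiable[OF smooth_partial_deriv[OF schwartz_smooth[OF f]]]]
    by (simp add: add.commute)
  have meas [measurable]: "?g \<in> borel_measurable borel" "?g2 i \<in> borel_measurable borel" for i
    by (intro smooth_borel_measurable smooth_g smooth_i)+
  have int1: "integrable lborel (\<lambda>y. ?g2 i y * ?K y)" for i
  proof -
    have "decaying (\<lambda>y. ?g2 i y * ?K y)"
      by (rule decaying_mult_bounded[OF decay(3)]) (use K_le[of _ 1] in simp)
    then show ?thesis
      by (rule decaying_integrable) simp
  qed
  have int2: "integrable lborel (\<lambda>y. ?g y * ?k2 i y)" for i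
    by (rule decaying_integrable[OF decaying_mult_bounded[OF decay(1) k2_le]]) simp
  have comp: "(\<integral>y. ?g2 i y * ?K y \<partial>lborel) = - (\<integral>y. ?g y * ?k2 i y \<partial>lborel)" for i
  proof -
    let ?e = "axis i 1 :: real^3"
    \<comment> \<open>This is \<open>\<partial>\<^sub>i f K - f \<partial>\<^sub>i K\<close>, with \<open>\<partial>\<^sub>i K\<close> written out.\<close>
    let ?w = "\<lambda>y. ?g1 i y * ?K y + ?g y * (y $ i * ?K y ^ 3)"
    have der_k1: "((\<lambda>y. y $ i * ?K y ^ 3) has_derivative
        (\<lambda>v. v $ i * ?K y ^ 3 - 3 * (y $ i) * (y \<bullet> v) * ?K y ^ 5)) (at y)" for y
      by (rule derivative_eq_intros refl has_derivative_reg_kernel[OF \<epsilon>]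
          bounded_linear_imp_has_derivative bounded_linear_vec_nth)+
        (auto simp: fun_eq_iff algebra_simps eval_nat_numeral)
    have der: "(?w has_derivative (\<lambda>v.
        (?g1 i y * (- (y \<bullet> v) * ?K y ^ 3) + dir_deriv v (partial_deriv i f) (x + y) * ?K y) +
        (?g y * (v $ i * ?K y ^ 3 - 3 * (y $ i) * (y \<bullet> v) * ?K y ^ 5)
          + dir_deriv v f (x + y) * (y $ i * ?K y ^ 3)))) (at y)" for y
      by (intro has_derivative_add has_derivative_mult der_g der_g1 der_k1 has_derivative_reg_kernel \<epsilon>)
    have w': "dir_deriv ?e ?w = (\<lambda>y. ?g2 i y * ?K y + ?g y * ?k2 i y)"
      by (intro ext dir_deriv_eqI[OF der, THEN trans])
        (simp add: partial_deriv_eq_dir_deriv inner_axis power2_eq_square algebra_simps)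
    have "(\<integral>y. dir_deriv ?e ?w y \<partial>lborel) = 0"
    proof (rule integral_dir_deriv_eq_0)
      show "?w differentiable (at y)" for y using der unfolding differentiable_def by blast
      show "decaying ?w"
        by (intro decaying_add decaying_mult_bounded[OF decay(1) k1_le]
            decaying_mult_bounded[OF decay(2), of _ "1 / \<epsilon>"]) (use K_le[of _ 1] in simp)
      show "decaying (dir_deriv ?e ?w)"
        unfolding w' by (intro decaying_add decaying_mult_bounded[OF decay(1) k2_le]
            decaying_mult_bounded[OF decay(3), of _ "1 / \<epsilon>"]) (use K_le[of _ 1] in simp)
      show "dir_deriv ?e ?w \<in> borel_measurable borel"
        unfolding w' by measurable
    qed
    then show ?thesis
      unfolding w' using int1 int2 by simp
  qed
  have "(\<integral>y. laplacian f (x + y) * ?K y \<partial>lborel) = (\<Sum>i\<in>UNIV. \<integral>y. ?g2 i y * ?K y \<partial>lborel)"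
    unfolding laplacian_def sum_distrib_right
    by (rule Bochner_Integration.integral_sum) (rule int1)
  also have "\<dots> = - (\<integral>y. (\<Sum>i\<in>UNIV. ?g y * ?k2 i y) \<partial>lborel)"
    unfolding comp sum_negf by (subst Bochner_Integration.integral_sum) (rule int2, simp)
  also have "(\<lambda>y. \<Sum>i\<in>UNIV. ?g y * ?k2 i y) = (\<lambda>y. ?g y * (3 * \<epsilon>\<^sup>2 * ?K y ^ 5))"
  proof
    fix y :: "real^3"
    have "?K y ^ 3 = ?K y ^ 3 * (((norm y)\<^sup>2 + \<epsilon>\<^sup>2) * ?K y ^ 2)"
      using reg_kernel_inverse_square(2)[OF \<epsilon>] by simp
    also have "\<dots> = ((norm y)\<^sup>2 + \<epsilon>\<^sup>2) * ?K y ^ 5" by (simp add: eval_nat_numeral)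
    finally have K3: "?K y ^ 3 = ((norm y)\<^sup>2 + \<epsilon>\<^sup>2) * ?K y ^ 5" .
    have norm_y: "(norm y)\<^sup>2 = (y $ 1)\<^sup>2 + (y $ 2)\<^sup>2 + (y $ 3)\<^sup>2"
      unfolding power2_norm_eq_inner inner_vec_def sum_3 by (simp add: power2_eq_square)
    show "(\<Sum>i\<in>UNIV. ?g y * ?k2 i y) = ?g y * (3 * \<epsilon>\<^sup>2 * ?K y ^ 5)"
      unfolding sum_3 K3 norm_y by (simp add: algebra_simps)
  qed
  finally show ?thesis .
qed

lemma integral_scale:
  fixes F :: "real^3 \<Rightarrow> real"
  assumes "F \<in> borel_measurable borel" "\<epsilon> > 0"
  shows "(\<integral>y. F y \<partial>lborel) = (\<integral>z. \<epsilon> ^ 3 * F (\<epsilon> *\<^sub>R z) \<partial>lborel)"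
proof -
  have [measurable]: "F \<in> borel_measurable borel" by fact
  have "(\<integral>y. F y \<partial>lborel)
      = (\<integral>y. F y \<partial>density (distr lborel borel (\<lambda>z::real^3. 0 + \<epsilon> *\<^sub>R z)) (\<lambda>_. ennreal (\<bar>\<epsilon>\<bar> ^ DIM(real^3))))"
    using assms(2) by (subst lborel_affine[of \<epsilon> 0]) (simp_all add: ennreal_power)
  also have "\<dots> = (\<integral>y. \<epsilon> ^ 3 * F y \<partial>distr lborel borel (\<lambda>z::real^3. 0 + \<epsilon> *\<^sub>R z))"
    using assms(2) by (subst integral_density) auto
  also have "\<dots> = (\<integral>z. \<epsilon> ^ 3 * F (\<epsilon> *\<^sub>R z) \<partial>lborel)"
    by (subst integral_distr) auto
  finally show ?thesis .
qed

lemma reg_kernel_scale: "\<epsilon> > 0 \<Longrightarrow> reg_kernel \<epsilon> (\<epsilon> *\<^sub>R z) = reg_kernel 1 z / \<epsilon>"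
proof -
  assume \<epsilon>: "\<epsilon> > 0"
  have "(norm (\<epsilon> *\<^sub>R z))\<^sup>2 + \<epsilon>\<^sup>2 = \<epsilon>\<^sup>2 * ((norm z)\<^sup>2 + 1\<^sup>2)"
    by (simp add: algebra_simps power_mult_distrib)
  then show ?thesis
    using \<epsilon> by (simp add: reg_kernel_def real_sqrt_mult divide_inverse)
qed

text \<open>
  The number \<open>4 \<pi>\<close>.
\<close>

definition newton_const :: real where
  "newton_const = (\<integral>z. 3 * reg_kernel 1 z ^ 5 \<partial>lborel)"

lemma newton_const_pos: "newton_const > 0"
proof -
  have int: "integrable lborel (\<lambda>z. 3 * reg_kernel 1 z ^ 5)"
    using integrable_reg_kernel_pow5 by simp
  have pos: "3 * reg_kernel 1 z ^ 5 > 0" for z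
    using reg_kernel_inverse_square(1)[of 1 z] by simp
  have "newton_const \<noteq> 0"
  proof
    assume "newton_const = 0"
    then have "AE z in (lborel :: (real^3) measure). 3 * reg_kernel 1 z ^ 5 = 0"
      using integral_nonneg_eq_0_iff_AE[OF int] less_imp_le[OF pos]
      by (simp add: newton_const_def)
    then have "AE z in (lborel :: (real^3) measure). False"
      by eventually_elim (metis pos less_irrefl)
    then show False
      by (simp add: AE_iff_measurable[OF _ refl] ennreal_zero_neq_top[symmetric])
  qed
  moreover have "newton_const \<ge> 0"
    unfolding newton_const_def by (intro integral_nonneg_AE AE_I2 less_imp_le[OF pos])
  ultimately show ?thesis by simp
qed

text \<open>
  Both sides of Green's identity are evaluated as \<open>\<epsilon>\<close> tends to zero.  On the left \<open>K\<^sub>\<epsilon>\<close> increases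
  to \<open>1/|y|\<close>, which serves as majorant.  On the right the substitution \<open>y = \<epsilon> z\<close> absorbs all powers
  of \<open>\<epsilon>\<close> into the kernel for \<open>\<epsilon> = 1\<close> and leaves \<open>f (x + \<epsilon> z)\<close>, which tends to \<open>f x\<close>.
\<close>

lemma newton_potential_laplacian:
  assumes f: "f \<in> schwartz"
  shows "newton_potential (laplacian f) x = - newton_const * f x"
proof -
  define \<epsilon> where "\<epsilon> n = inverse (real (Suc n))" for n
  have \<epsilon>: "\<epsilon> n > 0" for n by (simp add: \<epsilon>_def)
  have \<epsilon>_lim: "\<epsilon> \<longlonglongrightarrow> 0" unfolding \<epsilon>_def[abs_def] by (rule LIMSEQ_inverse_real_of_nat)
  have lap: "smooth (laplacian f)"
    unfolding laplacian_def[abs_def]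
    by (intro smooth_sum smooth_partial_deriv schwartz_smooth f) auto
  have [measurable]: "laplacian f \<in> borel_measurable borel" "f \<in> borel_measurable borel"
    by (intro smooth_borel_measurable lap schwartz_smooth f)+
  have int_lap: "integrable lborel (\<lambda>y. laplacian f (x + y) * inverse (norm y))"
    unfolding laplacian_def sum_distrib_right
    by (intro Bochner_Integration.integrable_sum dominated_family_integrable[OF dominated_newton]
        schwartz_partial_deriv f)
  have lim_kernel: "(\<lambda>n. \<integral>y. laplacian f (x + y) * reg_kernel (\<epsilon> n) y \<partial>lborel) \<longlonglongrightarrow> newton_potential (laplacian f) x"
    unfolding newton_potential_def
  proof (rule integral_dominated_convergence)
    show "integrable lborel (\<lambda>y. \<bar>laplacian f (x + y) * inverse (norm y)\<bar>)"
      using int_lap by (rule integrable_abs)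
    have nz: "AE y in lborel. y \<noteq> (0::real^3)" by (rule AE_lborel_singleton)
    then show "AE y in lborel. (\<lambda>n. laplacian f (x + y) * reg_kernel (\<epsilon> n) y)
        \<longlonglongrightarrow> laplacian f (x + y) * inverse (norm y)"
    proof eventually_elim
      fix y :: "real^3" assume "y \<noteq> 0"
      then have "(\<lambda>n. reg_kernel (\<epsilon> n) y) \<longlonglongrightarrow> inverse (sqrt ((norm y)\<^sup>2 + 0\<^sup>2))"
        unfolding reg_kernel_def by (intro tendsto_intros \<epsilon>_lim) simp
      then show "(\<lambda>n. laplacian f (x + y) * reg_kernel (\<epsilon> n) y)
          \<longlonglongrightarrow> laplacian f (x + y) * inverse (norm y)"
        by (intro tendsto_mult_left) simp
    qed
    fix n
    show "AE y in lborel. norm (laplacian f (x + y) * reg_kernel (\<epsilon> n) y)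
        \<le> \<bar>laplacian f (x + y) * inverse (norm y)\<bar>"
      using nz
    proof eventually_elim
      fix y :: "real^3" assume "y \<noteq> 0"
      have "norm y = sqrt ((norm y)\<^sup>2)" by simp
      also have "\<dots> \<le> sqrt ((norm y)\<^sup>2 + (\<epsilon> n)\<^sup>2)" by (intro real_sqrt_le_mono) simp
      finally have "reg_kernel (\<epsilon> n) y \<le> inverse (norm y)"
        unfolding reg_kernel_def using \<open>y \<noteq> 0\<close> by (intro le_imp_inverse_le) auto
      then show "norm (laplacian f (x + y) * reg_kernel (\<epsilon> n) y)
          \<le> \<bar>laplacian f (x + y) * inverse (norm y)\<bar>"
        using reg_kernel_inverse_square(1)[OF \<epsilon>[of n], of y]
        unfolding real_norm_def abs_mult by (intro mult_left_mono) auto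
    qed
  qed measurable
  have rescaled: "(\<integral>y. laplacian f (x + y) * reg_kernel (\<epsilon> n) y \<partial>lborel)
      = - (\<integral>z. f (x + \<epsilon> n *\<^sub>R z) * (3 * reg_kernel 1 z ^ 5) \<partial>lborel)" for n
  proof -
    have "(\<integral>y. f (x + y) * (3 * (\<epsilon> n)\<^sup>2 * reg_kernel (\<epsilon> n) y ^ 5) \<partial>lborel)
        = (\<integral>z. (\<epsilon> n)^3 * (f (x + \<epsilon> n *\<^sub>R z) * (3 * (\<epsilon> n)\<^sup>2 * reg_kernel (\<epsilon> n) (\<epsilon> n *\<^sub>R z) ^ 5)) \<partial>lborel)"
      by (rule integral_scale[OF _ \<epsilon>]) measurable
    also have "\<dots> = (\<integral>z. f (x + \<epsilon> n *\<^sub>R z) * (3 * reg_kernel 1 z ^ 5) \<partial>lborel)"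
      using \<epsilon>[of n] by (simp add: reg_kernel_scale[OF \<epsilon>] power_divide field_simps eval_nat_numeral)
    finally show ?thesis
      unfolding integral_laplacian_reg_kernel[OF f \<epsilon>] by simp
  qed
  have lim_rescaled: "(\<lambda>n. \<integral>z. f (x + \<epsilon> n *\<^sub>R z) * (3 * reg_kernel 1 z ^ 5) \<partial>lborel)
      \<longlonglongrightarrow> (\<integral>z. f x * (3 * reg_kernel 1 z ^ 5) \<partial>lborel)"
  proof -
    have "decay_weight y \<le> 1" for y
    proof -
      have "1 / (1 + r\<^sup>2) \<le> 1" for r :: real
        using add_pos_nonneg[OF zero_less_one zero_le_power2[of r]] by (simp add: divide_le_eq)
      then show ?thesis unfolding decay_weight_def by (intro prod_le_1 conjI) auto
    qed
    obtain C where C: "\<And>y. \<bar>f y\<bar> \<le> C * decay_weight y"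
      using schwartz_decaying[OF f] unfolding decaying_def by blast
    have "0 \<le> C * decay_weight 0" using C[of 0] by linarith
    then have "C \<ge> 0" using decay_weight_pos[of 0] by (simp add: zero_le_mult_iff)
    have f_le: "\<bar>f y\<bar> \<le> C" for y
      using C[of y] mult_left_mono[OF \<open>decay_weight y \<le> 1\<close> \<open>C \<ge> 0\<close>] by simp
    show ?thesis
    proof (rule integral_dominated_convergence)
      show "integrable lborel (\<lambda>z. C * (3 * reg_kernel 1 z ^ 5))"
        using integrable_reg_kernel_pow5 by simp
      show "AE z in lborel. (\<lambda>n. f (x + \<epsilon> n *\<^sub>R z) * (3 * reg_kernel 1 z ^ 5))
          \<longlonglongrightarrow> f x * (3 * reg_kernel 1 z ^ 5)"
      proof (intro AE_I2 tendsto_mult_right)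
        fix z
        have "(\<lambda>n. x + \<epsilon> n *\<^sub>R z) \<longlonglongrightarrow> x + 0 *\<^sub>R z" by (intro tendsto_intros \<epsilon>_lim)
        then show "(\<lambda>n. f (x + \<epsilon> n *\<^sub>R z)) \<longlonglongrightarrow> f x"
          by (intro continuous_on_tendsto_compose[OF smooth_continuous_on[OF schwartz_smooth[OF f], of UNIV]]) auto
      qed
      show "AE z in lborel. norm (f (x + \<epsilon> n *\<^sub>R z) * (3 * reg_kernel 1 z ^ 5)) \<le> C * (3 * reg_kernel 1 z ^ 5)" for n
        unfolding real_norm_def abs_mult
        using reg_kernel_inverse_square(1)[of 1]
        by (intro AE_I2 mult_mono f_le \<open>C \<ge> 0\<close>) (auto simp: less_imp_le)
    qed measurable
  qed
  have "newton_potential (laplacian f) x = - (\<integral>z. f x * (3 * reg_kernel 1 z ^ 5) \<partial>lborel)"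
    by (rule LIMSEQ_unique[OF lim_kernel]) (unfold rescaled, rule tendsto_minus[OF lim_rescaled])
  then show ?thesis by (simp add: newton_const_def)
qed

theorem poisson_equation_solvable:
  assumes f: "f \<in> schwartz"
  obtains \<phi> where "smooth \<phi>" "\<And>x. laplacian \<phi> x = f x"
proof
  let ?\<phi> = "\<lambda>x. - inverse newton_const * newton_potential f x"
  show "smooth ?\<phi>" by (intro smooth_cmult smooth_newton_potential f)
  fix x
  have scale: "partial_deriv i (\<lambda>x. c * g x) = (\<lambda>x. c * partial_deriv i g x)"
    if "smooth g" for c i and g :: "real^3 \<Rightarrow> real"
    unfolding partial_deriv_eq_dir_deriv
    by (intro ext dir_deriv_eqI[OF has_derivative_mult_right[OF smooth_has_derivative[OF that]]])
  have "laplacian (newton_potential f) x = newton_potential (laplacian f) x"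
  proof -
    have "newton_potential (laplacian f) x
        = (\<Sum>i\<in>UNIV. newton_potential (partial_deriv i (partial_deriv i f)) x)"
      unfolding newton_potential_def laplacian_def sum_distrib_right
      by (intro Bochner_Integration.integral_sum dominated_family_integrable[OF dominated_newton]
          schwartz_partial_deriv f)
    then show ?thesis
      unfolding laplacian_def by (simp add: partial_deriv_newton_potential schwartz_partial_deriv f)
  qed
  then have "laplacian (newton_potential f) x = - newton_const * f x"
    by (simp add: newton_potential_laplacian f)
  moreover have "laplacian ?\<phi> x = - inverse newton_const * laplacian (newton_potential f) x"
    unfolding laplacian_def sum_distrib_left
    by (simp only: scale smooth_newton_potential smooth_partial_deriv f)
  ultimately show "laplacian ?\<phi> x = f x"
    using newton_const_pos by simp
qed

section \<open>Scalar potentials and gradient fields in space-time\<close>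

abbreviation space_deriv :: "3 \<Rightarrow> ((real^3) \<times> real \<Rightarrow> real) \<Rightarrow> (real^3) \<times> real \<Rightarrow> real" where
  "space_deriv i \<equiv> dir_deriv (axis i 1, 0)"

abbreviation time_dir_deriv ::
    "((real^3) \<times> real \<Rightarrow> 'b::real_normed_vector) \<Rightarrow> (real^3) \<times> real \<Rightarrow> 'b" where
  "time_dir_deriv \<equiv> dir_deriv (0, 1)"

definition space_laplacian :: "((real^3) \<times> real \<Rightarrow> real) \<Rightarrow> (real^3) \<times> real \<Rightarrow> real" where
  "space_laplacian F z = (\<Sum>i\<in>UNIV. space_deriv i (space_deriv i F) z)"

text \<open>
  The derivatives of a curried field at a fixed time or a fixed place are derivatives of the joint
  function along a coordinate axis of space-time, where the calculus of smooth functions applies.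
\<close>

lemma partial_deriv_slice:
  fixes F :: "(real^3) \<times> real \<Rightarrow> real"
  assumes "smooth F"
  shows "partial_deriv i (\<lambda>y. F (y, t)) = (\<lambda>x. space_deriv i F (x, t))"
proof
  fix x :: "real^3"
  have "((\<lambda>y. (y, t)) has_derivative (\<lambda>v. (v, 0))) (at x)"
    by (intro has_derivative_Pair has_derivative_ident has_derivative_const)
  from has_derivative_compose[OF this smooth_has_derivative[OF assms]]
  show "partial_deriv i (\<lambda>y. F (y, t)) x = space_deriv i F (x, t)"
    unfolding partial_deriv_eq_dir_deriv by (rule dir_deriv_eqI)
qed

lemma time_deriv_slice:
  fixes F :: "(real^3) \<times> real \<Rightarrow> 'b::real_normed_vector"
  assumes "smooth F"
  shows "time_deriv (\<lambda>x t. F (x, t)) = (\<lambda>x t. time_dir_deriv F (x, t))"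
proof (intro ext)
  fix x :: "real^3" and t :: real
  interpret bounded_linear "\<lambda>v. dir_deriv v F (x, t)"
    by (rule has_derivative_bounded_linear[OF smooth_has_derivative[OF assms]])
  have "((\<lambda>s. (x, s)) has_derivative (\<lambda>r. (0, r))) (at t)"
    by (intro has_derivative_Pair has_derivative_ident has_derivative_const)
  from has_derivative_compose[OF this smooth_has_derivative[OF assms]]
  have "((\<lambda>s. F (x, s)) has_derivative (\<lambda>r. dir_deriv (0, r) F (x, t))) (at t)" .
  moreover have "(\<lambda>r. dir_deriv (0, r) F (x, t)) = (\<lambda>r. r *\<^sub>R time_dir_deriv F (x, t))"
  proof
    fix r
    show "dir_deriv (0, r) F (x, t) = r *\<^sub>R time_dir_deriv F (x, t)"
      using scaleR[of r "(0, 1)"] by simp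
  qed
  ultimately have "((\<lambda>s. F (x, s)) has_vector_derivative time_dir_deriv F (x, t)) (at t)"
    by (simp only: has_vector_derivative_def)
  then show "time_deriv (\<lambda>x t. F (x, t)) x t = time_dir_deriv F (x, t)"
    unfolding time_deriv_def by (rule vector_derivative_at)
qed

lemma laplacian_slice:
  assumes "smooth F"
  shows "laplacian (\<lambda>y. F (y, t)) x = space_laplacian F (x, t)"
  unfolding laplacian_def space_laplacian_def
  by (simp add: partial_deriv_slice assms smooth_dir_deriv)

lemma wave_op_slice:
  assumes "smooth F"
  shows "wave_op \<epsilon>\<^sub>0 \<mu>\<^sub>0 (\<lambda>x t. F (x, t)) x t
    = space_laplacian F (x, t) - \<mu>\<^sub>0 * \<epsilon>\<^sub>0 * time_dir_deriv (time_dir_deriv F) (x, t)"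
  unfolding wave_op_def by (simp add: laplacian_slice time_deriv_slice assms smooth_dir_deriv)

lemma dir_deriv_cmult:
  fixes F :: "'a::euclidean_space \<Rightarrow> real"
  assumes "smooth F"
  shows "dir_deriv v (\<lambda>z. c * F z) = (\<lambda>z. c * dir_deriv v F z)"
  by (intro ext dir_deriv_eqI[OF has_derivative_mult_right[OF smooth_has_derivative[OF assms]]])

lemma dir_deriv_space_laplacian:
  assumes "smooth F"
  shows "dir_deriv v (space_laplacian F) = space_laplacian (dir_deriv v F)"
proof
  fix z
  have "(space_laplacian F has_derivative
      (\<lambda>v. \<Sum>i\<in>UNIV. dir_deriv v (space_deriv i (space_deriv i F)) z)) (at z)"
    unfolding space_laplacian_def[abs_def]
    by (intro has_derivative_sum smooth_has_derivative smooth_dir_deriv assms)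
  from dir_deriv_eqI[OF this]
  have "dir_deriv v (space_laplacian F) z = (\<Sum>i\<in>UNIV. dir_deriv v (space_deriv i (space_deriv i F)) z)" .
  also have "\<dots> = space_laplacian (dir_deriv v F) z"
    unfolding space_laplacian_def
  proof (intro sum.cong refl)
    fix i :: 3
    show "dir_deriv v (space_deriv i (space_deriv i F)) z = space_deriv i (space_deriv i (dir_deriv v F)) z"
      by (simp only: dir_deriv_commute[OF smooth_dir_deriv[OF assms], of v]
          dir_deriv_commute[OF assms, of v])
  qed
  finally show "dir_deriv v (space_laplacian F) z = space_laplacian (dir_deriv v F) z" .
qed

lemma space_laplacian_cmult:
  assumes "smooth F"
  shows "space_laplacian (\<lambda>z. c * F z) = (\<lambda>z. c * space_laplacian F z)"
  by (simp add: fun_eq_iff space_laplacian_def dir_deriv_cmult smooth_dir_deriv assms sum_distrib_left)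

definition gradient_field :: "((real^3) \<times> real \<Rightarrow> real) \<Rightarrow> real^3 \<Rightarrow> real \<Rightarrow> real^3" where
  "gradient_field \<Psi> x t = (\<chi> i. space_deriv i \<Psi> (x, t))"

lemma smooth_gradient: "smooth \<Psi> \<Longrightarrow> smooth (\<lambda>z. \<chi> i. space_deriv i \<Psi> z)"
  by (intro smooth_vec smooth_dir_deriv)

lemma smooth_field_gradient_field: "smooth \<Psi> \<Longrightarrow> smooth_field (gradient_field \<Psi>)"
  using smooth_gradient[of \<Psi>] by (simp add: smooth_field_def gradient_field_def case_prod_unfold)

lemma divergence_gradient_field:
  "smooth \<Psi> \<Longrightarrow> divergence (\<lambda>y. gradient_field \<Psi> y t) x = space_laplacian \<Psi> (x, t)"
  by (simp add: divergence_def gradient_field_def space_laplacian_def partial_deriv_slice smooth_dir_deriv)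

lemma curl_gradient_field:
  assumes "smooth \<Psi>"
  shows "curl (\<lambda>y. gradient_field \<Psi> y t) x = 0"
  using dir_deriv_commute[OF assms]
  by (simp add: curl_def gradient_field_def partial_deriv_slice smooth_dir_deriv assms
      vec_eq_iff forall_3)

lemma time_deriv_gradient_field:
  assumes \<Psi>: "smooth \<Psi>"
  shows "time_deriv (gradient_field \<Psi>) x t = gradient_field (time_dir_deriv \<Psi>) x t"
proof -
  have "((\<lambda>z. \<chi> i. space_deriv i \<Psi> z) has_derivative
      (\<lambda>v. \<chi> i. dir_deriv v (space_deriv i \<Psi>) z)) (at z)" for z
    by (subst has_derivative_componentwise_within)
      (auto simp: Basis_vec_def inner_axis intro!: smooth_has_derivative smooth_dir_deriv \<Psi>)
  from dir_deriv_eqI[OF this]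
  have "time_deriv (\<lambda>x t. \<chi> i. space_deriv i \<Psi> (x, t)) x t = (\<chi> i. time_dir_deriv (space_deriv i \<Psi>) (x, t))"
    by (simp add: time_deriv_slice[OF smooth_gradient[OF \<Psi>]])
  then show ?thesis
    by (simp add: gradient_field_def[abs_def] dir_deriv_commute[OF \<Psi>, of "(0, 1)"])
qed

text \<open>
  The wave operator has constant coefficients, so it commutes with the gradient.
\<close>

lemma wave_op_vec_gradient_field:
  assumes \<Psi>: "smooth \<Psi>"
    and wave: "space_laplacian \<Psi> = (\<lambda>z. \<mu>\<^sub>0 * \<epsilon>\<^sub>0 * time_dir_deriv (time_dir_deriv \<Psi>) z)"
  shows "wave_op_vec \<epsilon>\<^sub>0 \<mu>\<^sub>0 (gradient_field \<Psi>) x t = 0"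
proof -
  have "space_laplacian (space_deriv i \<Psi>)
      = (\<lambda>z. \<mu>\<^sub>0 * \<epsilon>\<^sub>0 * time_dir_deriv (time_dir_deriv (space_deriv i \<Psi>)) z)" for i
  proof -
    have "space_laplacian (space_deriv i \<Psi>) = space_deriv i (space_laplacian \<Psi>)"
      by (rule dir_deriv_space_laplacian[OF \<Psi>, symmetric])
    also have "\<dots> = (\<lambda>z. \<mu>\<^sub>0 * \<epsilon>\<^sub>0 * space_deriv i (time_dir_deriv (time_dir_deriv \<Psi>)) z)"
      unfolding wave by (intro dir_deriv_cmult smooth_dir_deriv \<Psi>)
    finally show ?thesis
      by (simp only: dir_deriv_commute[OF smooth_dir_deriv[OF \<Psi>], of "(axis i 1, 0)"]
          dir_deriv_commute[OF \<Psi>, of "(axis i 1, 0)"])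
  qed
  then show ?thesis
    by (simp add: wave_op_vec_def gradient_field_def wave_op_slice smooth_dir_deriv \<Psi> vec_eq_iff)
qed

section \<open>A scalar potential for the fields\<close>

lemma time_antideriv_cmult: "time_antideriv (\<lambda>z. c * F z) = (\<lambda>z. c * time_antideriv F z)"
proof
  fix z
  have "time_moment_family 0 (\<lambda>z. c * F z) u z = c * time_moment_family 0 F u z" for u
    by (simp add: time_moment_family_def)
  then show "time_antideriv (\<lambda>z. c * F z) z = c * time_antideriv F z"
    by (simp add: time_antideriv_def time_moment_def)
qed

lemma time_antideriv_sum:
  fixes F :: "'i \<Rightarrow> 'a::euclidean_space \<times> real \<Rightarrow> real"
  assumes "\<And>i. i \<in> I \<Longrightarrow> smooth (F i)"
  shows "time_antideriv (\<lambda>z. \<Sum>i\<in>I. F i z) = (\<lambda>z. \<Sum>i\<in>I. time_antideriv (F i) z)"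
proof
  fix z
  have "time_moment_family 0 (\<lambda>z. \<Sum>i\<in>I. F i z) u z = (\<Sum>i\<in>I. time_moment_family 0 (F i) u z)" for u
    by (simp add: time_moment_family_def sum_distrib_right)
  then have "time_moment 0 (\<lambda>z. \<Sum>i\<in>I. F i z) z = (\<Sum>i\<in>I. time_moment 0 (F i) z)"
    using dominated_family_integrable[OF dominated_time_moment_family[OF assms]]
    by (simp add: time_moment_def)
  then show "time_antideriv (\<lambda>z. \<Sum>i\<in>I. F i z) z = (\<Sum>i\<in>I. time_antideriv (F i) z)"
    by (simp add: time_antideriv_def sum_distrib_left)
qed

text \<open>
  Prescribed value \<open>\<phi>\<close> and vanishing time derivative at time zero, second time derivative \<open>\<kappa> F\<close>.
\<close>

definition wave_potential ::
    "real \<Rightarrow> (real^3 \<Rightarrow> real) \<Rightarrow> ((real^3) \<times> real \<Rightarrow> real) \<Rightarrow> (real^3) \<times> real \<Rightarrow> real" where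
  "wave_potential \<kappa> \<phi> F z = \<phi> (fst z) + \<kappa> * time_antideriv (time_antideriv F) z"

lemma smooth_wave_potential:
  assumes "smooth \<phi>" "smooth F"
  shows "smooth (wave_potential \<kappa> \<phi> F)"
proof -
  have "smooth (\<lambda>z::(real^3) \<times> real. \<phi> (fst z))"
    using smooth_comp_affine[OF bounded_linear_fst assms(1), of 0] by simp
  then show ?thesis
    unfolding wave_potential_def[abs_def]
    by (intro smooth_add smooth_cmult smooth_time_antideriv assms)
qed

lemma has_derivative_wave_potential:
  assumes "smooth \<phi>" "smooth F"
  shows "(wave_potential \<kappa> \<phi> F has_derivative (\<lambda>v. dir_deriv (fst v) \<phi> (fst z)
    + \<kappa> * dir_deriv v (time_antideriv (time_antideriv F)) z)) (at z)"
proof -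
  have "((\<lambda>z::(real^3) \<times> real. \<phi> (fst z)) has_derivative (\<lambda>v. dir_deriv (fst v) \<phi> (fst z))) (at z)"
    by (rule has_derivative_compose[OF has_derivative_fst[OF has_derivative_ident]
          smooth_has_derivative[OF assms(1)]])
  then show ?thesis
    unfolding wave_potential_def[abs_def]
    by (intro has_derivative_add has_derivative_mult_right smooth_has_derivative smooth_time_antideriv assms)
qed

lemma space_deriv_wave_potential:
  assumes "smooth \<phi>" "smooth F"
  shows "space_deriv i (wave_potential \<kappa> \<phi> F) = wave_potential \<kappa> (partial_deriv i \<phi>) (space_deriv i F)"
  by (intro ext dir_deriv_eqI[OF has_derivative_wave_potential[OF assms], THEN trans])
    (simp add: wave_potential_def partial_deriv_eq_dir_deriv space_deriv_time_antideriv
      smooth_time_antideriv assms)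

lemma time_deriv_wave_potential:
  assumes "smooth \<phi>" "smooth F"
  shows "time_dir_deriv (wave_potential \<kappa> \<phi> F) = (\<lambda>z. \<kappa> * time_antideriv F z)"
proof
  fix z :: "(real^3) \<times> real"
  have "dir_deriv 0 \<phi> (fst z) = 0"
    using linear_0[OF has_derivative_linear[OF smooth_has_derivative[OF assms(1)]]] .
  then show "time_dir_deriv (wave_potential \<kappa> \<phi> F) z = \<kappa> * time_antideriv F z"
    by (simp add: dir_deriv_eqI[OF has_derivative_wave_potential[OF assms]]
        time_deriv_time_antideriv smooth_time_antideriv assms)
qed

text \<open>
  The wave equation for \<open>F\<close> makes the Laplacian under the double time integral a second time
  derivative.  Integrating it twice from time zero returns \<open>F\<close> minus its initial value, the linear
  term in \<open>t\<close> being absent as \<open>F\<close> starts with zero velocity.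
\<close>

lemma space_laplacian_wave_potential:
  assumes \<phi>: "smooth \<phi>" and F: "smooth F"
    and wave: "space_laplacian F = (\<lambda>z. c * time_dir_deriv (time_dir_deriv F) z)"
    and init: "\<And>x. time_dir_deriv F (x, 0) = 0"
  shows "space_laplacian (wave_potential \<kappa> \<phi> F) (x, t) = laplacian \<phi> x + \<kappa> * c * (F (x, t) - F (x, 0))"
proof -
  let ?A = time_antideriv
  have "(\<Sum>i\<in>UNIV. ?A (?A (space_deriv i (space_deriv i F))) (x, t)) = ?A (?A (space_laplacian F)) (x, t)"
    unfolding space_laplacian_def[abs_def]
    by (simp add: time_antideriv_sum smooth_time_antideriv smooth_dir_deriv F)
  also have "\<dots> = c * ?A (?A (time_dir_deriv (time_dir_deriv F))) (x, t)"
    by (simp add: wave time_antideriv_cmult)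
  also have "?A (time_dir_deriv (time_dir_deriv F)) = time_dir_deriv F"
    by (simp add: fun_eq_iff time_antideriv_time_deriv smooth_dir_deriv F init)
  also have "?A (time_dir_deriv F) (x, t) = F (x, t) - F (x, 0)"
    by (rule time_antideriv_time_deriv[OF F])
  finally have "(\<Sum>i\<in>UNIV. ?A (?A (space_deriv i (space_deriv i F))) (x, t)) = c * (F (x, t) - F (x, 0))" .
  moreover have "space_laplacian (wave_potential \<kappa> \<phi> F) (x, t)
      = laplacian \<phi> x + \<kappa> * (\<Sum>i\<in>UNIV. ?A (?A (space_deriv i (space_deriv i F))) (x, t))"
    unfolding space_laplacian_def laplacian_def
    by (simp add: space_deriv_wave_potential \<phi> F smooth_partial_deriv smooth_dir_deriv)
      (simp add: wave_potential_def sum.distrib sum_distrib_left)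
  ultimately show ?thesis by simp
qed

theorem lemma2p4:
  fixes \<epsilon>\<^sub>0 \<mu>\<^sub>0 :: real and \<rho> :: "real^3 \<Rightarrow> real \<Rightarrow> real"
  assumes "\<epsilon>\<^sub>0 > 0" and "\<mu>\<^sub>0 > 0"
    and "smooth_field \<rho>"
    and "\<forall>x t. wave_op \<epsilon>\<^sub>0 \<mu>\<^sub>0 \<rho> x t = 0"
    and "\<forall>x. time_deriv \<rho> x 0 = 0"
    and "(\<lambda>x. \<rho> x 0) \<in> schwartz"
  shows "\<exists>J :: real^3 \<Rightarrow> real \<Rightarrow> real^3. smooth_field J \<and>
           (\<forall>x t. time_deriv \<rho> x t + divergence (\<lambda>y. J y t) x = 0) \<and>
           (\<forall>x t. wave_op_vec \<epsilon>\<^sub>0 \<mu>\<^sub>0 J x t = 0) \<and>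
           (\<forall>x t. curl (\<lambda>y. J y t) x = 0) \<and>
           (\<exists>E B :: real^3 \<Rightarrow> real \<Rightarrow> real^3. smooth_field E \<and> smooth_field B \<and>
              maxwell \<epsilon>\<^sub>0 \<mu>\<^sub>0 \<rho> J E B \<and>
              (\<forall>x t. wave_op_vec \<epsilon>\<^sub>0 \<mu>\<^sub>0 E x t = 0) \<and>
              (\<forall>x t. B x t = 0) \<and>
              (\<forall>x t. cross3 (E x t) (B x t) = 0))"
proof -
  define R where "R = (\<lambda>(x, t). \<rho> x t)"
  have R: "smooth R" using assms(3) by (simp add: R_def smooth_field_def)
  have \<rho>: "\<rho> = (\<lambda>x t. R (x, t))" by (simp add: R_def)
  have wave: "space_laplacian R = (\<lambda>z. \<mu>\<^sub>0 * \<epsilon>\<^sub>0 * time_dir_deriv (time_dir_deriv R) z)"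
    using assms(4) by (simp add: \<rho> wave_op_slice[OF R] fun_eq_iff)
  have init: "time_dir_deriv R (x, 0) = 0" for x
    using assms(5) by (simp add: \<rho> time_deriv_slice[OF R])
  obtain \<psi> where \<psi>: "smooth \<psi>" "\<And>x. laplacian \<psi> x = R (x, 0)"
    using poisson_equation_solvable[OF assms(6)] by (auto simp: \<rho>)
  \<comment> \<open>The factor \<open>\<kappa>\<close> is the square of the speed of propagation.\<close>
  define \<kappa> where "\<kappa> = 1 / (\<mu>\<^sub>0 * \<epsilon>\<^sub>0)"
  define \<Phi> where "\<Phi> = (\<lambda>z. 1 / \<epsilon>\<^sub>0 * wave_potential \<kappa> \<psi> R z)"
  have W: "smooth (wave_potential \<kappa> \<psi> R)" by (intro smooth_wave_potential \<psi>(1) R)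
  have \<Phi>: "smooth \<Phi>" unfolding \<Phi>_def by (intro smooth_cmult W)
  have \<Phi>_lap: "space_laplacian \<Phi> = (\<lambda>z. 1 / \<epsilon>\<^sub>0 * R z)"
  proof -
    have "\<kappa> * (\<mu>\<^sub>0 * \<epsilon>\<^sub>0) = 1" using assms(1,2) by (simp add: \<kappa>_def)
    then have "space_laplacian (wave_potential \<kappa> \<psi> R) z = R z" for z
      using space_laplacian_wave_potential[OF \<psi>(1) R wave init, of \<kappa> "fst z" "snd z"]
      by (simp add: \<psi>(2))
    then show ?thesis unfolding \<Phi>_def space_laplacian_cmult[OF W] by simp
  qed
  have \<Phi>_t: "time_dir_deriv \<Phi> = (\<lambda>z. 1 / \<epsilon>\<^sub>0 * (\<kappa> * time_antideriv R z))"
    unfolding \<Phi>_def by (simp only: dir_deriv_cmult[OF W] time_deriv_wave_potential[OF \<psi>(1) R])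
  have \<Phi>_tt: "time_dir_deriv (time_dir_deriv \<Phi>) = (\<lambda>z. 1 / \<epsilon>\<^sub>0 * (\<kappa> * R z))"
    unfolding \<Phi>_t
    by (simp only: dir_deriv_cmult smooth_cmult smooth_time_antideriv[OF R]
        time_deriv_time_antideriv[OF R])
  have \<Phi>_wave: "space_laplacian \<Phi> = (\<lambda>z. \<mu>\<^sub>0 * \<epsilon>\<^sub>0 * time_dir_deriv (time_dir_deriv \<Phi>) z)"
    using assms(1,2) by (simp add: \<Phi>_lap \<Phi>_tt \<kappa>_def)
  \<comment> \<open>The scalar potential of the current.\<close>
  define \<Theta> where "\<Theta> = (\<lambda>z. - \<epsilon>\<^sub>0 * time_dir_deriv \<Phi> z)"
  have \<Theta>: "smooth \<Theta>" unfolding \<Theta>_def by (intro smooth_cmult smooth_dir_deriv \<Phi>)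
  have \<Theta>_lap: "space_laplacian \<Theta> = (\<lambda>z. - time_dir_deriv R z)"
  proof -
    have "space_laplacian \<Theta> = (\<lambda>z. - \<epsilon>\<^sub>0 * time_dir_deriv (space_laplacian \<Phi>) z)"
      unfolding \<Theta>_def
      by (simp only: space_laplacian_cmult[OF smooth_dir_deriv[OF \<Phi>]] dir_deriv_space_laplacian[OF \<Phi>])
    then show ?thesis
      unfolding \<Phi>_lap dir_deriv_cmult[OF R] using assms(1) by simp
  qed
  have \<Theta>_wave: "space_laplacian \<Theta> = (\<lambda>z. \<mu>\<^sub>0 * \<epsilon>\<^sub>0 * time_dir_deriv (time_dir_deriv \<Theta>) z)"
  proof -
    have "time_dir_deriv (time_dir_deriv \<Theta>) = (\<lambda>z. - \<epsilon>\<^sub>0 * time_dir_deriv (time_dir_deriv (time_dir_deriv \<Phi>)) z)"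
      unfolding \<Theta>_def by (simp only: dir_deriv_cmult smooth_dir_deriv \<Phi>)
    also have "time_dir_deriv (time_dir_deriv (time_dir_deriv \<Phi>)) = (\<lambda>z. 1 / \<epsilon>\<^sub>0 * (\<kappa> * time_dir_deriv R z))"
      unfolding \<Phi>_tt by (simp only: dir_deriv_cmult smooth_cmult R)
    finally show ?thesis
      using assms(1,2) by (simp add: \<Theta>_lap \<kappa>_def)
  qed
  let ?E = "gradient_field \<Phi>" and ?J = "gradient_field \<Theta>" and ?B = "\<lambda>x t. 0 :: real^3"
  have J_eq: "?J x t = - \<epsilon>\<^sub>0 *\<^sub>R time_deriv ?E x t" for x t
    unfolding time_deriv_gradient_field[OF \<Phi>] \<Theta>_def gradient_field_def
    by (simp only: dir_deriv_cmult[OF smooth_dir_deriv[OF \<Phi>]]) (simp add: vec_eq_iff)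
  have maxwell: "maxwell \<epsilon>\<^sub>0 \<mu>\<^sub>0 \<rho> ?J ?E ?B"
    unfolding maxwell_def
  proof (intro allI conjI)
    fix x t
    show "divergence (\<lambda>y. ?E y t) x = \<rho> x t / \<epsilon>\<^sub>0"
      by (simp add: divergence_gradient_field[OF \<Phi>] \<Phi>_lap \<rho>)
    have const: "partial_deriv i (\<lambda>y. 0) = (\<lambda>y. 0)" for i
      by (simp add: partial_deriv_def fun_eq_iff frechet_derivative_const)
    show "divergence (\<lambda>y. 0) x = 0" by (simp add: divergence_def const)
    show "curl (\<lambda>y. ?E y t) x = - time_deriv ?B x t"
      by (simp add: curl_gradient_field[OF \<Phi>] time_deriv_def)
    show "curl (\<lambda>y. 0) x = \<mu>\<^sub>0 *\<^sub>R ?J x t + (\<mu>\<^sub>0 * \<epsilon>\<^sub>0) *\<^sub>R time_deriv ?E x t"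
      by (simp add: J_eq curl_def const vec_eq_iff forall_3)
  qed
  show ?thesis
  proof (intro exI conjI allI)
    show "smooth_field ?J" "smooth_field ?E" by (intro smooth_field_gradient_field \<Theta> \<Phi>)+
    show "smooth_field ?B" by (simp add: smooth_field_def smooth_const case_prod_unfold)
    fix x t
    show "time_deriv \<rho> x t + divergence (\<lambda>y. ?J y t) x = 0"
      by (simp add: divergence_gradient_field[OF \<Theta>] \<Theta>_lap \<rho> time_deriv_slice[OF R])
    show "wave_op_vec \<epsilon>\<^sub>0 \<mu>\<^sub>0 ?J x t = 0" by (rule wave_op_vec_gradient_field[OF \<Theta> \<Theta>_wave])
    show "wave_op_vec \<epsilon>\<^sub>0 \<mu>\<^sub>0 ?E x t = 0" by (rule wave_op_vec_gradient_field[OF \<Phi> \<Phi>_wave])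
    show "curl (\<lambda>y. ?J y t) x = 0" by (rule curl_gradient_field[OF \<Theta>])
    show "cross3 (?E x t) 0 = 0" by (simp add: cross3_simps)
  qed (simp_all add: maxwell)
qed

end
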